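(* Let $\mathcal F$ be a standard construction of degree $d_{\mathcal F}$, let $V_n=\mathcal F(\mathbb R^n)$, let $\mathcal F(\mathcal D)$ be the associated $\mathcal D$-sequence with embeddings $\psi_{N,n}=\mathcal F(\delta_{N,n})$ ($n\mid N$), and let $\mathcal F(\mathcal Z)$ be the corresponding $\mathcal Z$-sequence with embeddings $\varphi_{N,n}=\mathcal F(\zeta_{N,n})$ ($n\le N$). Let $(\Omega_n\subseteq V_n)_n$ be a sequence of compact $\mathfrak S_n$-invariant sets satisfying $\psi_{N,n}^\star\Omega_N\subseteq\Omega_n$ whenever $n\mid N$, $\varphi_{N,n}\Omega_n\subseteq\Omega_N$ whenever $n\le N$, and $\sup_n\sup_{x\in\Omega_n}\|x\|_1<\infty$. Consider the map from freely-symmetrized measures $\varinjlim_{\mathcal F(\mathcal Z)}\mathcal P(\Omega_n)^{\mathfrak S_n}$ over $\mathcal F(\mathcal Z)$ to freely-described measures $\varprojlim_{\mathcal F(\mathcal D)}\mathcal P(\Omega_m)^{\mathfrak S_m}$ over $\mathcal F(\mathcal D)$ sending $$\left(\mathrm{sym}_N^{\mathcal F(\mathcal Z)}\mu_n\right)_{N\ge n}\ \mapsto\ \big(\mathrm{Law}(\rho(F_{m,n})^\star X)\big)_m,$$ where $X\sim\mu_n$ is independent of the uniformly random map $F_{m,n}:[n]\to[m]$. This map has a dense image in the Wasserstein distance $W_1$ with respect to $\|\cdot\|_1$ on $(V_n)$; that is, for any $(\mu_m)\in\varprojlim_{\mathcal F(\mathcal D)}\mathcal P(\Omega_m)^{\mathfrak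 S_m}$ there is a sequence $(\mu^{(i)}_m)_m$, $i=1,2,\dots$, of elements of the image with $\lim_{i\to\infty}W_1(\mu_m,\mu_m^{(i)})=0$ for each $m$. More precisely, for any $\mu_n\in\mathcal P(V_n)^{\mathfrak S_n}$ and any $m\mid n$ we have $$W_1\big(\mathrm{Law}(\psi_{n,m}^\star X),\mathrm{Law}(\rho(F_{m,n})^\star X)\big)\le 2d_{\mathcal F}\sqrt{\frac{m(m-1)}{n/m}}\ \mathbb E_{\mu_n}\big[\|X\|_1\big]$$ and $$\big\|\mathbb E\,\psi_{n,m}^\star X-\mathbb E\,\rho(F_{m,n})^\star X\big\|_1\le\frac{d_{\mathcal F}(d_{\mathcal F}-1)}{n}\ \mathbb E_{\mu_n}\|X\|_1,$$ where $X\sim\mu_n$ is independent of $F_{m,n}$.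
   Context: Conventions. Dimension indices $n,m,k,N,M$ are positive integers; $[n]=\{1,\dots,n\}$; $n\mid N$ is divisibility; $\mathfrak S_n$ is the symmetric group on $[n]$. Vector spaces are finite-dimensional real inner product spaces and $A^\star$ is the adjoint of $A$. $\mathbb R^n$ has its standard basis and inner product, and $\mathfrak S_n$ acts by $(\sigma x)_i=x_{\sigma^{-1}(i)}$. Standard constructions. A standard construction $\mathcal F$ is built inductively from the identity construction using finitely many of the following operations, each producing spaces $\mathcal F(\mathbb R^n)$ and, for each linear $A:\mathbb R^n\to\mathbb R^m$, a linear map $\mathcal F(A):\mathcal F(\mathbb R^n)\to\mathcal F(\mathbb R^m)$: the product $\mathcal F_1\times\mathcal F_2$ (with $\mathcal F_1(A)\times\mathcal F_2(A)$); the tensor product $\mathcal F_1\otimes\mathcal F_2$ (with $\mathcal F_1(A)\otimes\mathcal F_2(A)$); the symmetric power $\mathrm{Sym}^k\mathcal F_1$, viewed as symmetric tensors (with $\mathcal F_1(A)^{\otimes k}$ restricted to symmetric tensors); and homogeneous degree-$k$ polynomials $\mathbb R[\mathcal F_1]_k$ over $\mathcal F_1(\mathbb R^n)$ (with $p\mapsto p\circ\mathcal F_1(A)^\star$); $\mathbb R[\mathcal F_1]_0=\mathbb R$ is trivial, and $\mathbb R[\mathcal F_1]_{\le k}=\mathbb R[\mathcal F_1]_0\times\cdots\times\mathbb R[\mathcal F_1]_k$. Degree: $\deg\mathrm{id}=1$, $\deg(\mathcal F_1\times\mathcal F_2)=\max\{\deg\mathcal F_1,\deg\mathcal F_2\}$,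 $\deg(\mathcal F_1\otimes\mathcal F_2)=\deg\mathcal F_1+\deg\mathcal F_2$, $\deg\mathrm{Sym}^k\mathcal F_1=\deg\mathbb R[\mathcal F_1]_k=k\deg\mathcal F_1$. Bases and inner products. If $(e_\alpha)_{\alpha\in\mathcal A}$, $(e_\beta)_{\beta\in\mathcal B}$ are the orthogonal bases of $W,U$: $W\times U$ has basis $(e_\alpha,0),(0,e_\beta)$ and the sum inner product; $W\otimes U$ has basis $e_\alpha\otimes e_\beta$ and the product inner product; $\mathrm{Sym}^kW$ has basis the orbit sums $E_{[\alpha_1,\dots,\alpha_k]}=\sum e_{\alpha_1'}\otimes\cdots\otimes e_{\alpha_k'}$ over distinct rearrangements $(\alpha_i')$ of $(\alpha_i)$, and the inner product making $E_{[\alpha_1,\dots,\alpha_k]}/\sqrt{\prod_i\langle e_{\alpha_i},e_{\alpha_i}\rangle}$ orthonormal; $\mathbb R[W]_k$ has basis the monomials $m_\mu(x)=\prod_\alpha\langle x,e_\alpha\rangle^{\mu_\alpha}$, $|\mu|=k$, and the Bombieri inner product making $m_\mu\big/\sqrt{\tfrac{\mu!}{k!}\prod_\alpha\langle e_\alpha,e_\alpha\rangle^{\mu_\alpha}}$ orthonormal. The norm $\|\cdot\|_1$ on $V_n=\mathcal F(\mathbb R^n)$ is the $\ell_1$-norm of the coordinates in the basis so constructed from the standard basis of $\mathbb R^n$. Maps between finite sets. For $f:[n]\to[m]$ let $\rho(f):\mathbb R^m\to\mathbb R^n$, $(\rho(f)x)_i=x_{f(i)}$; also write $\rho(f)$ for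 $\mathcal F(\rho(f)):V_m\to V_n$, with adjoint $\rho(f)^\star:V_n\to V_m$. Sequences. $\mathcal Z$ consists of $(\mathbb R^n)$ with zero-padding embeddings $\zeta_{N,n}(x)=(x,0_{N-n})$ for $n\le N$; $\mathcal D$ consists of $(\mathbb R^n)$ with duplication embeddings $\delta_{N,n}(x)=x\otimes\mathbf 1_{N/n}=(x_1,\dots,x_1,\dots,x_n,\dots,x_n)$ (each entry repeated $N/n$ times) for $n\mid N$. $\mathcal F(\mathcal Z)$ and $\mathcal F(\mathcal D)$ are the spaces $V_n$ with $\mathfrak S_n$-action $\mathcal F(\sigma)$ and embeddings $\mathcal F(\zeta_{N,n})$, resp. $\mathcal F(\delta_{N,n})$. Measures. $\mathcal P(\Omega)$ is the set of Borel probability measures on $\Omega$, and $\mathcal P(\Omega)^{\mathfrak S_n}$ the $\mathfrak S_n$-invariant ones. $\varprojlim_{\mathcal F(\mathcal D)}\mathcal P(\Omega_m)^{\mathfrak S_m}$ is the set of sequences $(\mu_m)_m$ with $\mu_m\in\mathcal P(\Omega_m)^{\mathfrak S_m}$ such that the pushforward of $\mu_M$ under $\psi_{M,m}^\star$ is $\mu_m$ for all $m\mid M$. For $n\le N$, $\mathrm{sym}_N^{\mathcal F(\mathcal Z)}\mu_n=\mathrm{Law}(\Pi_N\varphi_{N,n}X)$ with $X\sim\mu_n$ and $\Pi_N$ an independent uniformly random element of $\mathfrak S_N$. $\varinjlim_{\mathcal F(\mathcal Z)}\mathcal P(\Omega_n)^{\mathfrak S_n}$ is $\bigsqcup_n\mathcal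 P(\Omega_n)^{\mathfrak S_n}$ modulo the equivalence relation generated by $\mu_n\sim\mathrm{sym}_N^{\mathcal F(\mathcal Z)}\mu_n$ for $n\le N$; the class of $\mu_n$ is written $(\mathrm{sym}_N^{\mathcal F(\mathcal Z)}\mu_n)_{N\ge n}$. $W_1(\mu,\nu)=\inf\mathbb E\|X-Y\|_1$ over couplings $(X,Y)$ of $\mu,\nu$. If $\mathbb E_{\mu_n}\|X\|_1=\infty$ the error bounds are regarded as vacuous. *)

theory Defs
  imports "HOL-Probability.Probability" "HOL-Combinatorics.Permutations"
begin

section \<open>Standard constructions\<close>

datatype construction =
    CId
  | CProd construction construction
  | CTensor construction construction
  | CSym nat construction
  | CPoly nat construction

primrec deg :: "construction \<Rightarrow> nat" where
  "deg CId = 1"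
| "deg (CProd F G) = max (deg F) (deg G)"
| "deg (CTensor F G) = deg F + deg G"
| "deg (CSym k F) = k * deg F"
| "deg (CPoly k F) = k * deg F"

text \<open>
  Labels of the constructed basis vectors: \<open>IdxE i\<close> is the standard basis vector \<open>e\<^sub>i\<close>,
  \<open>IdxL a\<close> and \<open>IdxR b\<close> are \<open>(e\<^sub>a, 0)\<close> and \<open>(0, e\<^sub>b)\<close>, \<open>IdxT a b\<close> is the tensor
  product of \<open>e\<^sub>a\<close> and \<open>e\<^sub>b\<close>.  In a symmetric power \<open>IdxM M\<close> is the orbit sum \<open>E\<^sub>M\<close>,
  in a polynomial space it is the monomial whose exponent of \<open>\<langle>x, e\<^sub>a\<rangle>\<close> is \<open>count M a\<close>.
\<close>

datatype idx =
    IdxE nat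
  | IdxL idx
  | IdxR idx
  | IdxT idx idx
  | IdxM "idx multiset"

primrec basis :: "construction \<Rightarrow> nat \<Rightarrow> idx set" where
  "basis CId n = IdxE ` {1..n}"
| "basis (CProd F G) n = IdxL ` basis F n \<union> IdxR ` basis G n"
| "basis (CTensor F G) n = {IdxT a b | a b. a \<in> basis F n \<and> b \<in> basis G n}"
| "basis (CSym k F) n = IdxM ` {M. size M = k \<and> set_mset M \<subseteq> basis F n}"
| "basis (CPoly k F) n = IdxM ` {M. size M = k \<and> set_mset M \<subseteq> basis F n}"

text \<open>
  Elements of \<open>V\<^sub>n\<close> are coordinate functions with respect to this basis, zero off \<open>basis F n\<close>.
  The topology and the Borel sets of \<open>V\<^sub>n\<close> are the ones induced by the product topology
  on \<^typ>\<open>idx \<Rightarrow> real\<close>; as \<open>basis F n\<close> is finite they are the Euclidean ones.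
\<close>

type_synonym coords = "idx \<Rightarrow> real"

definition space_of :: "construction \<Rightarrow> nat \<Rightarrow> coords set" where
  "space_of F n = {x. \<forall>a. a \<notin> basis F n \<longrightarrow> x a = 0}"

definition unit_vec :: "'i \<Rightarrow> 'i \<Rightarrow> real" where
  "unit_vec j = (\<lambda>i. if i = j then 1 else 0)"

definition norm1 :: "construction \<Rightarrow> nat \<Rightarrow> coords \<Rightarrow> real" where
  "norm1 F n x = (\<Sum>a\<in>basis F n. \<bar>x a\<bar>)"

text \<open>
  \<open>wt F a\<close> is the squared norm \<open>\<langle>e\<^sub>a, e\<^sub>a\<rangle>\<close>.  In a symmetric power this is not the restriction of the
  inner product of the tensor power: there \<open>E\<^sub>M\<close> would get an extra factor, the number of listings
  of \<open>M\<close>.  In a polynomial space it is the Bombieri inner product.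
\<close>

primrec wt :: "construction \<Rightarrow> idx \<Rightarrow> real" where
  "wt CId = (\<lambda>_. 1)"
| "wt (CProd F G) = (\<lambda>c. case c of IdxL a \<Rightarrow> wt F a | IdxR b \<Rightarrow> wt G b | _ \<Rightarrow> 0)"
| "wt (CTensor F G) = (\<lambda>c. case c of IdxT a b \<Rightarrow> wt F a * wt G b | _ \<Rightarrow> 0)"
| "wt (CSym k F) = (\<lambda>c. case c of IdxM M \<Rightarrow> (\<Prod>a\<in>#M. wt F a) | _ \<Rightarrow> 0)"
| "wt (CPoly k F) = (\<lambda>c. case c of
      IdxM M \<Rightarrow> (\<Prod>a\<in>set_mset M. fact (count M a)) / fact k * (\<Prod>a\<in>#M. wt F a) | _ \<Rightarrow> 0)"

definition inner_on :: "construction \<Rightarrow> nat \<Rightarrow> coords \<Rightarrow> coords \<Rightarrow> real" where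
  "inner_on F n x y = (\<Sum>a\<in>basis F n. wt F a * x a * y a)"

text \<open>
  \<open>mat_entry F A a b\<close> is the coefficient of \<open>e\<^sub>a\<close> in the image of \<open>e\<^sub>b\<close> under \<open>F(A)\<close>, where vectors of
  \<open>R\<^sup>n\<close> are functions on \<^typ>\<open>nat\<close> of which only the entries \<open>1, \<dots>, n\<close> matter.

  In a symmetric power, the coefficient of \<open>E\<^sub>M\<close> in a symmetric tensor is its entry at any listing
  of \<open>M\<close>, and \<open>E\<^sub>N\<close> is the sum of the elementary tensors of all listings of \<open>N\<close>;
  see \<open>apply_map_Sym\<close> below.  For polynomials, \<open>m\<^sub>N\<close> composed with the adjoint of \<open>F(A)\<close> sends \<open>x\<close> to
  the product over \<open>b \<in># N\<close> of \<open>\<langle>x, F(A) e\<^sub>b\<rangle> = (\<Sum>a. mat_entry F A a b * \<langle>x, e\<^sub>a\<rangle>)\<close>, and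
  expanding it gives the entries below; see \<open>apply_map_Poly\<close>.
\<close>

primrec mat_entry :: "construction \<Rightarrow> ((nat \<Rightarrow> real) \<Rightarrow> nat \<Rightarrow> real) \<Rightarrow> idx \<Rightarrow> idx \<Rightarrow> real" where
  "mat_entry CId A = (\<lambda>a b. case (a, b) of (IdxE i, IdxE j) \<Rightarrow> A (unit_vec j) i | _ \<Rightarrow> 0)"
| "mat_entry (CProd F G) A = (\<lambda>a b. case (a, b) of
      (IdxL a', IdxL b') \<Rightarrow> mat_entry F A a' b'
    | (IdxR a', IdxR b') \<Rightarrow> mat_entry G A a' b'
    | _ \<Rightarrow> 0)"
| "mat_entry (CTensor F G) A = (\<lambda>a b. case (a, b) of
      (IdxT a1 a2, IdxT b1 b2) \<Rightarrow> mat_entry F A a1 b1 * mat_entry G A a2 b2 | _ \<Rightarrow> 0)"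
| "mat_entry (CSym k F) A = (\<lambda>a b. case (a, b) of
      (IdxM M, IdxM N) \<Rightarrow>
        (let us = (SOME us. mset us = M)
         in \<Sum>vs | mset vs = N. prod_list (map2 (mat_entry F A) us vs)) | _ \<Rightarrow> 0)"
| "mat_entry (CPoly k F) A = (\<lambda>a b. case (a, b) of
      (IdxM M, IdxM N) \<Rightarrow>
        (let vs = (SOME vs. mset vs = N)
         in \<Sum>us | mset us = M. prod_list (map2 (mat_entry F A) us vs)) | _ \<Rightarrow> 0)"

text \<open>The map \<open>F(A)\<close> from \<open>F(R\<^sup>n)\<close> to \<open>F(R\<^sup>m)\<close> for a linear map \<open>A\<close> from \<open>R\<^sup>n\<close> to \<open>R\<^sup>m\<close>.\<close>

definition apply_map ::
  "construction \<Rightarrow> nat \<Rightarrow> nat \<Rightarrow> ((nat \<Rightarrow> real) \<Rightarrow> nat \<Rightarrow> real) \<Rightarrow> coords \<Rightarrow> coords" where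
  "apply_map F n m A x =
     (\<lambda>a. if a \<in> basis F m then \<Sum>b\<in>basis F n. mat_entry F A a b * x b else 0)"

text \<open>
  The adjoint of a linear map \<open>T\<close> from \<open>V\<^sub>n\<close> to \<open>V\<^sub>m\<close>, expanded in the orthogonal basis of \<open>V\<^sub>n\<close>;
  see \<open>inner_on_adj\<close>.
\<close>

definition adj :: "construction \<Rightarrow> nat \<Rightarrow> nat \<Rightarrow> (coords \<Rightarrow> coords) \<Rightarrow> coords \<Rightarrow> coords" where
  "adj F n m T y =
     (\<lambda>b. if b \<in> basis F n then inner_on F m (T (unit_vec b)) y / wt F b else 0)"


section \<open>Maps between the spaces\<close>

definition rho :: "(nat \<Rightarrow> nat) \<Rightarrow> (nat \<Rightarrow> real) \<Rightarrow> nat \<Rightarrow> real" where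
  "rho f x = (\<lambda>i. x (f i))"

definition perm_act :: "(nat \<Rightarrow> nat) \<Rightarrow> (nat \<Rightarrow> real) \<Rightarrow> nat \<Rightarrow> real" where
  "perm_act \<sigma> x = (\<lambda>i. x (inv \<sigma> i))"

definition zero_pad :: "nat \<Rightarrow> (nat \<Rightarrow> real) \<Rightarrow> nat \<Rightarrow> real" where
  "zero_pad n x = (\<lambda>i. if i \<le> n then x i else 0)"

definition duplicate :: "nat \<Rightarrow> nat \<Rightarrow> (nat \<Rightarrow> real) \<Rightarrow> nat \<Rightarrow> real" where
  "duplicate N n x = (\<lambda>i. x ((i - 1) div (N div n) + 1))"

definition act :: "construction \<Rightarrow> nat \<Rightarrow> (nat \<Rightarrow> nat) \<Rightarrow> coords \<Rightarrow> coords" where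
  "act F n \<sigma> = apply_map F n n (perm_act \<sigma>)"

definition phi :: "construction \<Rightarrow> nat \<Rightarrow> nat \<Rightarrow> coords \<Rightarrow> coords" where
  "phi F N n = apply_map F n N (zero_pad n)"

definition psi :: "construction \<Rightarrow> nat \<Rightarrow> nat \<Rightarrow> coords \<Rightarrow> coords" where
  "psi F N n = apply_map F n N (duplicate N n)"

definition psi_adj :: "construction \<Rightarrow> nat \<Rightarrow> nat \<Rightarrow> coords \<Rightarrow> coords" where
  "psi_adj F N n = adj F n N (psi F N n)"

text \<open>For \<open>f\<close> from \<open>[n]\<close> to \<open>[m]\<close>, the map \<open>\<rho>(f)\<close> goes from \<open>V\<^sub>m\<close> to \<open>V\<^sub>n\<close> and its adjoint from \<open>V\<^sub>n\<close> to \<open>V\<^sub>m\<close>.\<close>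

definition rho_adj :: "construction \<Rightarrow> nat \<Rightarrow> nat \<Rightarrow> (nat \<Rightarrow> nat) \<Rightarrow> coords \<Rightarrow> coords" where
  "rho_adj F m n f = adj F m n (apply_map F m n (rho f))"


section \<open>Measures\<close>

text \<open>
  Borel probability measures on a Borel set \<open>S\<close> are represented by the Borel probability measures
  on \<^typ>\<open>idx \<Rightarrow> real\<close> giving full mass to \<open>S\<close>.
\<close>

definition inv_prob :: "construction \<Rightarrow> nat \<Rightarrow> coords set \<Rightarrow> coords measure set" where
  "inv_prob F n S = {\<mu>. prob_space \<mu> \<and> sets \<mu> = sets borel \<and> emeasure \<mu> S = 1 \<and>
     (\<forall>\<sigma>. \<sigma> permutes {1..n} \<longrightarrow> distr \<mu> borel (act F n \<sigma>) = \<mu>)}"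

text \<open>Sequences indexed by the positive integers.\<close>

definition inv_lim :: "construction \<Rightarrow> (nat \<Rightarrow> coords set) \<Rightarrow> (nat \<Rightarrow> coords measure) set" where
  "inv_lim F \<Omega> = {\<mu> \<in> (\<Pi>\<^sub>E m\<in>{0<..}. inv_prob F m (\<Omega> m)).
     \<forall>m M. 0 < m \<longrightarrow> 0 < M \<longrightarrow> m dvd M \<longrightarrow> distr (\<mu> M) borel (psi_adj F M m) = \<mu> m}"

definition symmetrize :: "construction \<Rightarrow> nat \<Rightarrow> nat \<Rightarrow> coords measure \<Rightarrow> coords measure" where
  "symmetrize F N n \<mu> = distr (uniform_count_measure {\<sigma>. \<sigma> permutes {1..N}} \<Otimes>\<^sub>M \<mu>) borel
     (\<lambda>(\<sigma>, x). act F N \<sigma> (phi F N n x))"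

definition level_measures ::
  "construction \<Rightarrow> (nat \<Rightarrow> coords set) \<Rightarrow> (nat \<times> coords measure) set" where
  "level_measures F \<Omega> = (SIGMA n:{0<..}. inv_prob F n (\<Omega> n))"

definition sym_step ::
  "construction \<Rightarrow> (nat \<Rightarrow> coords set) \<Rightarrow> nat \<times> coords measure \<Rightarrow> nat \<times> coords measure \<Rightarrow> bool" where
  "sym_step F \<Omega> p q \<longleftrightarrow> p \<in> level_measures F \<Omega> \<and> q \<in> level_measures F \<Omega> \<and>
     fst p \<le> fst q \<and> snd q = symmetrize F (fst q) (fst p) (snd p)"

definition sym_equiv ::
  "construction \<Rightarrow> (nat \<Rightarrow> coords set) \<Rightarrow> (nat \<times> coords measure) rel" where
  "sym_equiv F \<Omega> = {(p, q). p \<in> level_measures F \<Omega> \<and> q \<in> level_measures F \<Omega> \<and>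
     equivclp (sym_step F \<Omega>) p q}"

definition dir_lim ::
  "construction \<Rightarrow> (nat \<Rightarrow> coords set) \<Rightarrow> (nat \<times> coords measure) set set" where
  "dir_lim F \<Omega> = level_measures F \<Omega> // sym_equiv F \<Omega>"

text \<open>The law of \<open>\<rho>(F\<^sub>m\<^sub>,\<^sub>n)\<^sup>\<star> X\<close>.\<close>

definition random_image :: "construction \<Rightarrow> nat \<Rightarrow> nat \<Rightarrow> coords measure \<Rightarrow> coords measure" where
  "random_image F m n \<mu> =
     distr (uniform_count_measure ({1..n} \<rightarrow>\<^sub>E {1..m}) \<Otimes>\<^sub>M \<mu>) borel (\<lambda>(f, x). rho_adj F m n f x)"

definition describe :: "construction \<Rightarrow> nat \<times> coords measure \<Rightarrow> nat \<Rightarrow> coords measure" where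
  "describe F = (\<lambda>(n, \<mu>). \<lambda>m\<in>{0<..}. random_image F m n \<mu>)"

text \<open>
  The map induced by \<open>describe F\<close> on classes; it is meaningful because \<open>describe F\<close> respects
  \<open>sym_equiv F \<Omega>\<close>, which is part of the theorem.
\<close>

definition describe_class ::
  "construction \<Rightarrow> (nat \<times> coords measure) set \<Rightarrow> nat \<Rightarrow> coords measure" where
  "describe_class F C = the_elem (describe F ` C)"

definition couplings :: "coords measure \<Rightarrow> coords measure \<Rightarrow> (coords \<times> coords) measure set" where
  "couplings \<mu> \<nu> = {\<pi>. sets \<pi> = sets (borel \<Otimes>\<^sub>M borel) \<and>
     distr \<pi> borel fst = \<mu> \<and> distr \<pi> borel snd = \<nu>}"

definition W1 :: "construction \<Rightarrow> nat \<Rightarrow> coords measure \<Rightarrow> coords measure \<Rightarrow> ennreal" where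
  "W1 F n \<mu> \<nu> =
     (INF \<pi>\<in>couplings \<mu> \<nu>. \<integral>\<^sup>+(x, y). ennreal (norm1 F n (\<lambda>a. x a - y a)) \<partial>\<pi>)"

definition mean :: "coords measure \<Rightarrow> coords" where
  "mean \<mu> = (\<lambda>a. \<integral>x. x a \<partial>\<mu>)"


section \<open>Consistency of the coordinate descriptions\<close>

lemma finite_multisets_of: "finite S \<Longrightarrow> finite {M. size M = k \<and> set_mset M \<subseteq> S}"
proof -
  assume "finite S"
  then have "finite (mset ` {xs. set xs \<subseteq> S \<and> length xs = k})"
    by (intro finite_imageI finite_lists_length_eq)
  moreover have "{M. size M = k \<and> set_mset M \<subseteq> S} \<subseteq> mset ` {xs. set xs \<subseteq> S \<and> length xs = k}"
  proof
    fix M assume "M \<in> {M. size M = k \<and> set_mset M \<subseteq> S}"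
    moreover obtain xs where "mset xs = M" using ex_mset by blast
    ultimately show "M \<in> mset ` {xs. set xs \<subseteq> S \<and> length xs = k}" by auto
  qed
  ultimately show ?thesis by (rule rev_finite_subset)
qed

lemma finite_basis: "finite (basis F n)"
proof (induction F)
  case (CTensor F G)
  have "basis (CTensor F G) n = (\<lambda>(a, b). IdxT a b) ` (basis F n \<times> basis G n)" by auto
  then show ?case using CTensor by (metis finite_SigmaI finite_imageI)
qed (auto intro: finite_multisets_of)

lemma wt_pos: "a \<in> basis F n \<Longrightarrow> 0 < wt F a"
proof (induction F arbitrary: a)
  case (CSym k F)
  have "0 < (\<Prod>a\<in>#M. wt F a)" if "set_mset M \<subseteq> basis F n" for M
    using that by (induction M) (auto simp: CSym.IH)
  with CSym show ?case by auto
next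
  case (CPoly k F)
  have "0 < (\<Prod>a\<in>#M. wt F a)" if "set_mset M \<subseteq> basis F n" for M
    using that by (induction M) (auto simp: CPoly.IH)
  with CPoly show ?case by (auto intro!: mult_pos_pos divide_pos_pos prod_pos)
qed auto

lemma apply_map_unit_vec:
  "a \<in> basis F m \<Longrightarrow> b \<in> basis F n \<Longrightarrow> apply_map F n m A (unit_vec b) a = mat_entry F A a b"
  by (simp add: apply_map_def unit_vec_def finite_basis if_distrib cong: if_cong)

lemma wt_adj:
  assumes "b \<in> basis F n"
  shows "wt F b * adj F n m (apply_map F n m A) y b = (\<Sum>a\<in>basis F m. mat_entry F A a b * (wt F a * y a))"
proof -
  have "wt F b \<noteq> 0" using wt_pos[OF assms] by simp
  then show ?thesis
    using assms by (simp add: adj_def inner_on_def apply_map_unit_vec mult_ac)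
qed

lemma inner_on_adj:
  "inner_on F m (apply_map F n m A x) y = inner_on F n x (adj F n m (apply_map F n m A) y)"
proof -
  have "inner_on F m (apply_map F n m A x) y =
    (\<Sum>a\<in>basis F m. \<Sum>b\<in>basis F n. x b * (mat_entry F A a b * (wt F a * y a)))"
    by (simp add: inner_on_def apply_map_def sum_distrib_left sum_distrib_right mult_ac)
  also have "\<dots> = (\<Sum>b\<in>basis F n. x b * (wt F b * adj F n m (apply_map F n m A) y b))"
    by (subst sum.swap) (simp add: wt_adj sum_distrib_left)
  also have "\<dots> = inner_on F n x (adj F n m (apply_map F n m A) y)"
    by (simp add: inner_on_def mult_ac)
  finally show ?thesis .
qed

text \<open>Sums over multisets of a given size as sums over lists.\<close>

lemma sum_lists_by_mset:
  fixes h :: "'a list \<Rightarrow> real"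
  assumes "finite S"
  shows "(\<Sum>M | size M = k \<and> set_mset M \<subseteq> S. \<Sum>xs | mset xs = M. h xs)
       = (\<Sum>xs | set xs \<subseteq> S \<and> length xs = k. h xs)"
proof -
  let ?L = "{xs. set xs \<subseteq> S \<and> length xs = k}" and ?T = "{M. size M = k \<and> set_mset M \<subseteq> S}"
  have "(\<Sum>xs\<in>?L. h xs) = (\<Sum>M\<in>?T. \<Sum>xs | xs \<in> ?L \<and> mset xs = M. h xs)"
    using assms by (intro sum.group[symmetric] finite_lists_length_eq finite_multisets_of) auto
  also have "\<dots> = (\<Sum>M\<in>?T. \<Sum>xs | mset xs = M. h xs)"
    by (intro sum.cong) auto
  finally show ?thesis ..
qed

lemma sum_listings_perm:
  fixes g :: "'a \<Rightarrow> 'b \<Rightarrow> real"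
  assumes "mset us = mset us'" "length us = size N"
  shows "(\<Sum>vs | mset vs = N. prod_list (map2 g us vs)) = (\<Sum>vs | mset vs = N. prod_list (map2 g us' vs))"
proof -
  obtain p where p: "p permutes {..<length us'}" "permute_list p us' = us"
    using mset_eq_permutation[OF assms(1)] by blast
  have len: "length us' = size N" using assms by (metis size_mset)
  have pN: "p permutes {..<length vs}" if "mset vs = N" for vs :: "'b list"
    using p(1) len that by auto
  have bij: "bij_betw (permute_list p) {vs. mset vs = N} {vs. mset vs = N}"
  proof (rule bij_betwI[where g = "permute_list (inv p)"])
    have ip: "inv p permutes {..<length vs}" if "mset vs = N" for vs :: "'b list"
      using permutes_inv[OF pN[OF that]] .
    show "permute_list p \<in> {vs. mset vs = N} \<rightarrow> {vs. mset vs = N}"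
      using pN by auto
    show "permute_list (inv p) \<in> {vs. mset vs = N} \<rightarrow> {vs. mset vs = N}"
      using ip by auto
    show "permute_list (inv p) (permute_list p vs) = vs" if "vs \<in> {vs. mset vs = N}" for vs
      using that ip[of vs]
      by (simp add: permute_list_compose[symmetric] permutes_inv_o(1)[OF p(1)] del: o_apply)
    show "permute_list p (permute_list (inv p) vs) = vs" if "vs \<in> {vs. mset vs = N}" for vs
      using that pN[of vs]
      by (simp add: permute_list_compose[symmetric] permutes_inv_o(2)[OF p(1)] del: o_apply)
  qed
  have "prod_list (map2 g us (permute_list p vs)) = prod_list (map2 g us' vs)" if "mset vs = N" for vs
  proof -
    have "length vs = length us'" using that len by auto
    then have "zip us (permute_list p vs) = permute_list p (zip us' vs)"
      using permute_list_zip[OF p(1) refl, of vs] p(2) by simp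
    then have "mset (zip us (permute_list p vs)) = mset (zip us' vs)"
      using p(1) \<open>length vs = length us'\<close> by (metis length_zip min.idem mset_permute_list)
    then have "mset (map2 g us (permute_list p vs)) = mset (map2 g us' vs)" by simp
    then show ?thesis by (metis prod_mset_prod_list)
  qed
  then show ?thesis
    using sum.reindex_bij_betw[OF bij, of "\<lambda>vs. prod_list (map2 g us vs)"] by simp
qed

text \<open>
  \<open>c (IdxM (mset us))\<close> is the entry at \<open>us\<close> of the symmetric tensor with coordinates \<open>c\<close>, so this
  says that \<open>CSym k F\<close> applies the \<open>k\<close>-th tensor power of \<open>F(A)\<close>.
\<close>

lemma apply_map_Sym:
  assumes us: "set us \<subseteq> basis F m" "length us = k"
  shows "apply_map (CSym k F) n m A c (IdxM (mset us)) =
    (\<Sum>vs | set vs \<subseteq> basis F n \<and> length vs = k.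
       prod_list (map2 (mat_entry F A) us vs) * c (IdxM (mset vs)))"
proof -
  let ?T = "{N. size N = k \<and> set_mset N \<subseteq> basis F n}"
  have entry: "mat_entry (CSym k F) A (IdxM (mset us)) (IdxM N) =
      (\<Sum>vs | mset vs = N. prod_list (map2 (mat_entry F A) us vs))" if "size N = k" for N
  proof -
    have "mset (SOME ws. mset ws = mset us) = mset us"
      by (rule someI[of "\<lambda>ws. mset ws = mset us"]) simp
    then show ?thesis
      using us(2) that by (auto simp: Let_def intro!: sum_listings_perm) (metis size_mset)
  qed
  have "IdxM (mset us) \<in> basis (CSym k F) m" using us by auto
  then have "apply_map (CSym k F) n m A c (IdxM (mset us)) =
      (\<Sum>N\<in>?T. mat_entry (CSym k F) A (IdxM (mset us)) (IdxM N) * c (IdxM N))"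
    by (simp add: apply_map_def sum.reindex inj_on_def del: mat_entry.simps)
  also have "\<dots> = (\<Sum>N\<in>?T. \<Sum>vs | mset vs = N. prod_list (map2 (mat_entry F A) us vs) * c (IdxM (mset vs)))"
    by (intro sum.cong) (auto simp: entry sum_distrib_right simp del: mat_entry.simps)
  also note sum_lists_by_mset[OF finite_basis]
  finally show ?thesis .
qed

text \<open>The polynomial on \<open>F(R\<^sup>n)\<close> with coordinates \<open>c\<close>; note that \<open>\<langle>x, e\<^sub>a\<rangle> = wt F a * x a\<close>.\<close>

definition poly_eval :: "construction \<Rightarrow> nat \<Rightarrow> nat \<Rightarrow> coords \<Rightarrow> coords \<Rightarrow> real" where
  "poly_eval F k n c x =
     (\<Sum>M | size M = k \<and> set_mset M \<subseteq> basis F n.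
        c (IdxM M) * (\<Prod>a\<in>#M. inner_on F n x (unit_vec a)))"

lemma inner_on_unit_vec: "a \<in> basis F n \<Longrightarrow> inner_on F n x (unit_vec a) = wt F a * x a"
  by (simp add: inner_on_def unit_vec_def finite_basis if_distrib cong: if_cong)

lemma prod_mset_listing:
  fixes h :: "'a \<Rightarrow> real"
  shows "(\<Prod>a\<in>#mset us. h a) = prod_list (map h us)"
  by (induction us) auto

lemma prod_list_sum_expand:
  fixes h :: "'a \<Rightarrow> 'b \<Rightarrow> real"
  assumes "finite S"
  shows "prod_list (map (\<lambda>v. \<Sum>u\<in>S. h u v) vs) =
    (\<Sum>us | set us \<subseteq> S \<and> length us = length vs. prod_list (map2 h us vs))"
proof (induction vs)
  case Nil
  have "{us. set us \<subseteq> S \<and> length us = 0} = {[]}" by auto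
  then show ?case by simp
next
  case (Cons v vs)
  let ?L = "{us. set us \<subseteq> S \<and> length us = length vs}"
  have eq: "{us. set us \<subseteq> S \<and> length us = length (v # vs)} = (\<lambda>(u, us). u # us) ` (S \<times> ?L)"
    by (auto simp: length_Suc_conv image_iff)
  have "(\<Sum>us | set us \<subseteq> S \<and> length us = length (v # vs). prod_list (map2 h us (v # vs))) =
    (\<Sum>(u, us)\<in>S \<times> ?L. h u v * prod_list (map2 h us vs))"
    unfolding eq by (subst sum.reindex) (auto simp: inj_on_def intro!: sum.cong)
  also have "\<dots> = (\<Sum>u\<in>S. h u v) * (\<Sum>us\<in>?L. prod_list (map2 h us vs))"
    by (simp add: sum.cartesian_product[symmetric] sum_product)
  finally show ?case using Cons by simp
qed

lemma apply_map_Poly: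
  "poly_eval F k m (apply_map (CPoly k F) n m A c) x =
   poly_eval F k n c (adj F n m (apply_map F n m A) x)"
proof -
  let ?T = "\<lambda>n. {N. size N = k \<and> set_mset N \<subseteq> basis F n}"
  let ?mon = "\<lambda>M. \<Prod>a\<in>#M. wt F a * x a"
  have mon: "(\<Prod>a\<in>#M. inner_on F n y (unit_vec a)) = (\<Prod>a\<in>#M. wt F a * y a)"
    if "set_mset M \<subseteq> basis F n" for M n y
  proof -
    have "image_mset (\<lambda>a. inner_on F n y (unit_vec a)) M = image_mset (\<lambda>a. wt F a * y a) M"
      using that by (intro image_mset_cong) (auto simp: inner_on_unit_vec)
    then show ?thesis by simp
  qed
  have col: "(\<Sum>M\<in>?T m. mat_entry (CPoly k F) A (IdxM M) (IdxM N) * ?mon M) =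
      (\<Prod>b\<in>#N. wt F b * adj F n m (apply_map F n m A) x b)" if N: "N \<in> ?T n" for N
  proof -
    define vs where "vs = (SOME vs. mset vs = N)"
    have vs: "mset vs = N" unfolding vs_def by (rule someI_ex) (rule ex_mset)
    have len: "length vs = k" using vs N by auto
    have pl: "prod_list (map2 (mat_entry F A) us vs) * ?mon (mset us) =
        prod_list (map2 (\<lambda>a b. mat_entry F A a b * (wt F a * x a)) us vs)" if "length us = length vs" for us
    proof -
      have "prod_list (map2 (mat_entry F A) us vs) * prod_list (map (\<lambda>a. wt F a * x a) us) =
        prod_list (map2 (\<lambda>a b. mat_entry F A a b * (wt F a * x a)) us vs)"
        using that by (induction us vs rule: list_induct2) (auto simp: mult_ac)
      then show ?thesis by (simp add: prod_mset_listing)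
    qed
    have "(\<Sum>M\<in>?T m. mat_entry (CPoly k F) A (IdxM M) (IdxM N) * ?mon M) =
        (\<Sum>M\<in>?T m. \<Sum>us | mset us = M. prod_list (map2 (mat_entry F A) us vs) * ?mon (mset us))"
      by (intro sum.cong refl) (simp add: vs_def sum_distrib_right)
    also have "\<dots> = (\<Sum>us | set us \<subseteq> basis F m \<and> length us = k.
        prod_list (map2 (mat_entry F A) us vs) * ?mon (mset us))"
      by (rule sum_lists_by_mset[OF finite_basis])
    also have "\<dots> = (\<Sum>us | set us \<subseteq> basis F m \<and> length us = length vs.
        prod_list (map2 (\<lambda>a b. mat_entry F A a b * (wt F a * x a)) us vs))"
      unfolding len[symmetric] by (intro sum.cong refl pl) simp
    also have "\<dots> = prod_list (map (\<lambda>b. \<Sum>a\<in>basis F m. mat_entry F A a b * (wt F a * x a)) vs)"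
      by (rule prod_list_sum_expand[OF finite_basis, symmetric])
    also have "map (\<lambda>b. \<Sum>a\<in>basis F m. mat_entry F A a b * (wt F a * x a)) vs =
        map (\<lambda>b. wt F b * adj F n m (apply_map F n m A) x b) vs"
    proof (intro map_cong refl)
      fix b assume "b \<in> set vs"
      then have "b \<in> basis F n" using vs N by auto
      then show "(\<Sum>a\<in>basis F m. mat_entry F A a b * (wt F a * x a)) =
          wt F b * adj F n m (apply_map F n m A) x b"
        by (rule wt_adj[symmetric])
    qed
    also have "prod_list \<dots> = (\<Prod>b\<in>#N. wt F b * adj F n m (apply_map F n m A) x b)"
      by (simp only: prod_mset_listing vs[symmetric])
    finally show ?thesis .
  qed
  have "poly_eval F k m (apply_map (CPoly k F) n m A c) x =
      (\<Sum>M\<in>?T m. (\<Sum>N\<in>?T n. mat_entry (CPoly k F) A (IdxM M) (IdxM N) * c (IdxM N)) * ?mon M)"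
    unfolding poly_eval_def
    by (intro sum.cong refl)
      (auto simp: mon apply_map_def sum.reindex inj_on_def simp del: mat_entry.simps)
  also have "\<dots> = (\<Sum>N\<in>?T n. c (IdxM N) * (\<Sum>M\<in>?T m. mat_entry (CPoly k F) A (IdxM M) (IdxM N) * ?mon M))"
    unfolding sum_distrib_left sum_distrib_right by (subst sum.swap) (simp only: mult_ac)
  also have "\<dots> = (\<Sum>N\<in>?T n. c (IdxM N) * (\<Prod>b\<in>#N. wt F b * adj F n m (apply_map F n m A) x b))"
    by (intro sum.cong refl) (simp only: col)
  also have "\<dots> = poly_eval F k n c (adj F n m (apply_map F n m A) x)"
    unfolding poly_eval_def by (intro sum.cong refl) (simp add: mon)
  finally show ?thesis .
qed

end

theory Submission
  imports Defs "HOL-Combinatorics.Multiset_Permutations"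
begin

text \<open>
  In the constructed bases \<open>\<rho>(f)\<^sup>\<star>\<close> sends \<open>e\<^sub>a\<close> to \<open>e\<^sub>f\<^sub>(\<^sub>a\<^sub>)\<close>, with coefficient one for every standard
  construction, where \<open>f\<close> acts on a label \<open>a\<close> through the at most \<open>deg F\<close> indices occurring in it.
  The adjoint of the duplication embedding is the case of the block map from \<open>[n]\<close> to \<open>[m]\<close>, and
  permutations and zero-padding act in the same way, so compatibility of the two limits reduces to the
  fact that composing a uniformly random map with a map with equal fibres, or restricting it along an
  injection, gives a uniformly random map.

  For the \<open>W\<^sub>1\<close> bound, a random \<open>f\<close> is coupled with a permuted block map that differs from \<open>f\<close> in at most
  \<open>\<Sum>\<^sub>j \<bar>card (f\<^sup>-\<^sup>1 j) - n / m\<bar>\<close> points, whose expectation is at most \<open>sqrt (n * (m - 1))\<close>.  For the bound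
  on means, sampling with and without replacement agree at a label unless two of its indices collide.
  Density follows by letting \<open>n\<close> run through the factorials.
\<close>

section \<open>Relabelling of basis vectors\<close>

text \<open>Coefficient one depends on the chosen inner products: an adjoint introduces a quotient
  of weights, and in a polynomial space the multinomial factor of the Bombieri weight is what
  cancels the number of listings. The obstacle for the \<open>W1\<close> bound is that a random map
  has unequal fibres, so in general no permuted block map equals it. A disagreement at one index
  moves only labels containing that index. By exchangeability these carry at most the fraction
  \<open>deg F / n\<close> of the expected norm, and a displaced coordinate costs twice its size, as
  it leaves one place and arrives at another. With at most \<open>sqrt (n * (m - 1))\<close>
  disagreements on average this gives the constant \<open>2 * deg F * sqrt ((m - 1) / n)\<close>,
  which times \<open>m\<close> is the claimed one. For the means, a label has at most
  \<open>deg F * (deg F - 1)\<close> ordered pairs of distinct indices, each colliding with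
  probability \<open>1 / n\<close>; the loss of at most 2 in a collision is paid for by the two
  orders of a colliding pair.\<close>

primrec imap :: "(nat \<Rightarrow> nat) \<Rightarrow> idx \<Rightarrow> idx" where
  "imap f (IdxE i) = IdxE (f i)"
| "imap f (IdxL a) = IdxL (imap f a)"
| "imap f (IdxR a) = IdxR (imap f a)"
| "imap f (IdxT a b) = IdxT (imap f a) (imap f b)"
| "imap f (IdxM M) = IdxM (image_mset (imap f) M)"

primrec isupp :: "idx \<Rightarrow> nat set" where
  "isupp (IdxE i) = {i}"
| "isupp (IdxL a) = isupp a"
| "isupp (IdxR a) = isupp a"
| "isupp (IdxT a b) = isupp a \<union> isupp b"
| "isupp (IdxM M) = \<Union> (set_mset (image_mset isupp M))"

lemma imap_cong: "(\<And>i. i \<in> isupp a \<Longrightarrow> f i = g i) \<Longrightarrow> imap f a = imap g a"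
  by (induction a) (auto intro!: image_mset_cong)

lemma imap_id: "(\<And>i. i \<in> isupp a \<Longrightarrow> f i = i) \<Longrightarrow> imap f a = a"
proof (induction a)
  case (IdxM M)
  then have "image_mset (imap f) M = image_mset (\<lambda>a. a) M"
    by (intro image_mset_cong) auto
  then show ?case by simp
qed auto

lemma imap_comp: "imap f (imap g a) = imap (f \<circ> g) a"
  by (induction a) (auto simp: multiset.map_comp intro!: image_mset_cong)

lemma imap_basis: "a \<in> basis F n \<Longrightarrow> f \<in> {1..n} \<rightarrow> {1..m} \<Longrightarrow> imap f a \<in> basis F m"
proof (induction F arbitrary: a)
  case (CSym k F)
  then obtain M where "a = IdxM M" "size M = k" "set_mset M \<subseteq> basis F n" by auto
  moreover from this have "imap f ` set_mset M \<subseteq> basis F m" using CSym by blast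
  ultimately show ?case by simp
next
  case (CPoly k F)
  then obtain M where "a = IdxM M" "size M = k" "set_mset M \<subseteq> basis F n" by auto
  moreover from this have "imap f ` set_mset M \<subseteq> basis F m" using CPoly by blast
  ultimately show ?case by simp
qed auto

text \<open>Members are counted with multiplicity, which produces the factor \<open>k\<close> in the
  degree of a \<open>k\<close>-th power.\<close>

lemma card_UN_mset_le:
  "(\<And>a. a \<in># M \<Longrightarrow> finite (g a) \<and> card (g a) \<le> d) \<Longrightarrow>
    finite (\<Union>a\<in>set_mset M. g a) \<and> card (\<Union>a\<in>set_mset M. g a) \<le> size M * d"
proof (induction M)
  case (add x M)
  have "card (g x \<union> (\<Union>a\<in>set_mset M. g a)) \<le> card (g x) + card (\<Union>a\<in>set_mset M. g a)"
    by (rule card_Un_le)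
  also have "\<dots> \<le> d + size M * d"
    using add by (intro add_mono) auto
  finally show ?case using add by auto
qed auto

text \<open>The degree enters both error bounds only through this count of the distinct points of
  \<open>[n]\<close> that a label involves.\<close>

lemma isupp_basis:
  "a \<in> basis F n \<Longrightarrow> isupp a \<subseteq> {1..n} \<and> finite (isupp a) \<and> card (isupp a) \<le> deg F"
proof (induction F arbitrary: a)
  case (CProd F G)
  from CProd.prems consider b where "a = IdxL b" "b \<in> basis F n" | b where "a = IdxR b" "b \<in> basis G n"
    by auto
  then show ?case by cases (use CProd.IH in \<open>simp_all add: le_max_iff_disj\<close>)
next
  case (CTensor F G)
  then obtain b c where a: "a = IdxT b c" "b \<in> basis F n" "c \<in> basis G n" by auto
  then have "card (isupp b \<union> isupp c) \<le> deg F + deg G"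
    using CTensor.IH by (meson add_mono card_Un_le le_trans)
  then show ?case using a CTensor.IH by auto
next
  case (CSym k F)
  then obtain M where M: "a = IdxM M" "size M = k" "set_mset M \<subseteq> basis F n" by auto
  moreover have "finite (\<Union>b\<in>set_mset M. isupp b) \<and> card (\<Union>b\<in>set_mset M. isupp b) \<le> size M * deg F"
    using M CSym.IH by (intro card_UN_mset_le) blast
  moreover have "(\<Union>b\<in>set_mset M. isupp b) \<subseteq> {1..n}" using M CSym.IH by blast
  ultimately show ?case by simp
next
  case (CPoly k F)
  then obtain M where M: "a = IdxM M" "size M = k" "set_mset M \<subseteq> basis F n" by auto
  moreover have "finite (\<Union>b\<in>set_mset M. isupp b) \<and> card (\<Union>b\<in>set_mset M. isupp b) \<le> size M * deg F"
    using M CPoly.IH by (intro card_UN_mset_le) blast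
  moreover have "(\<Union>b\<in>set_mset M. isupp b) \<subseteq> {1..n}" using M CPoly.IH by blast
  ultimately show ?case by simp
qed auto

lemma imap_cong_basis:
  "a \<in> basis F n \<Longrightarrow> (\<And>i. i \<in> {1..n} \<Longrightarrow> f i = g i) \<Longrightarrow> imap f a = imap g a"
  using isupp_basis by (intro imap_cong) blast

lemma imap_inverse_basis:
  "a \<in> basis F n \<Longrightarrow> (\<And>i. i \<in> {1..n} \<Longrightarrow> g (h i) = i) \<Longrightarrow> imap g (imap h a) = a"
  unfolding imap_comp using isupp_basis[of a F n] by (intro imap_id) (auto dest!: subsetD)

text \<open>Carries the identity of \<open>mat_entry_rho\<close> from a construction to its powers.
  With the weight \<open>u\<close> beside the entry and the weight \<open>v\<close> on the other
  side, the identity is multiplicative along lists and needs no division.\<close>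

lemma prod_list_map2_scaled:
  fixes r :: "'a \<Rightarrow> 'b \<Rightarrow> real"
  assumes "length us = length vs"
    and "\<And>a b. a \<in> set us \<Longrightarrow> b \<in> set vs \<Longrightarrow> r a b * u a = (if g a = b then v b else 0)"
  shows "prod_list (map2 r us vs) * (\<Prod>a\<in>#mset us. u a) =
    (if map g us = vs then (\<Prod>b\<in>#mset vs. v b) else 0)"
  using assms
proof (induction us vs rule: list_induct2)
  case (Cons a us b vs)
  have "r a b * u a = (if g a = b then v b else 0)" using Cons.prems by simp
  moreover have "prod_list (map2 r us vs) * (\<Prod>a\<in>#mset us. u a) =
      (if map g us = vs then (\<Prod>b\<in>#mset vs. v b) else 0)"
    using Cons by simp
  moreover have "prod_list (map2 r (a # us) (b # vs)) * (\<Prod>a\<in>#mset (a # us). u a) =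
    (r a b * u a) * (prod_list (map2 r us vs) * (\<Prod>a\<in>#mset us. u a))" by simp
  ultimately show ?case by simp
qed simp

lemma prod_list_map2_indicator:
  assumes "length us = length vs"
    and "\<And>a b. a \<in> set us \<Longrightarrow> b \<in> set vs \<Longrightarrow> r a b = (if a = h b then 1 else (0::real))"
  shows "prod_list (map2 r us vs) = (if us = map h vs then 1 else 0)"
  using assms by (induction us vs rule: list_induct2) auto

section \<open>Matrix entries of relabellings\<close>

lemma finite_listings: "finite {vs. mset vs = N}"
  using finite_permutations_of_multiset[of N] by (simp add: permutations_of_multiset_def)

lemma some_listing: "mset (SOME us. mset us = M) = M"
  by (rule someI_ex) (rule ex_mset)

text \<open>Serves permutations and zero-padding, where the map itself and not its adjoint relabels
  the basis. A symmetric power sums over all listings of \<open>N\<close>; injectivity of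
  \<open>h\<close> leaves at most one that is carried to the chosen listing of \<open>M\<close>,
  while a map that merges points could carry several there and give a coefficient above one.\<close>

lemma mat_entry_injective:
  assumes "\<And>i j. i \<in> {1..m} \<Longrightarrow> j \<in> {1..n} \<Longrightarrow> A (unit_vec j) i = (if i = h j then 1 else 0)"
    and "inj_on h {1..n}" and "a \<in> basis F m" "b \<in> basis F n"
  shows "mat_entry F A a b = (if a = imap h b then 1 else 0)"
  using assms(3,4)
proof (induction F arbitrary: a b)
  case CId
  then show ?case using assms(1) by auto
next
  case (CSym k F)
  then obtain M N where M: "a = IdxM M" "size M = k" "set_mset M \<subseteq> basis F m"
    and N: "b = IdxM N" "size N = k" "set_mset N \<subseteq> basis F n" by auto
  define us where "us = (SOME us. mset us = M)"
  have us: "mset us = M" unfolding us_def by (rule some_listing)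
  have ent: "prod_list (map2 (mat_entry F A) us vs) = (if us = map (imap h) vs then 1 else 0)"
    if "mset vs = N" for vs
  proof (rule prod_list_map2_indicator)
    show "length us = length vs" using us that M N by (metis size_mset)
    show "mat_entry F A a b = (if a = imap h b then 1 else 0)" if "a \<in> set us" "b \<in> set vs" for a b
      using that \<open>mset vs = N\<close> us M N by (intro CSym.IH) auto
  qed
  define g where "g = the_inv_into {1..n} h"
  have inv1: "imap g (imap h c) = c" if "c \<in># N" for c
  proof (rule imap_inverse_basis)
    show "c \<in> basis F n" using that N by auto
    show "g (h i) = i" if "i \<in> {1..n}" for i
      using that assms(2) by (simp add: g_def the_inv_into_f_f)
  qed
  have inv: "map (imap g) (map (imap h) vs) = vs" if "mset vs = N" for vs
    using that inv1 by (auto intro!: map_idI)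
  have "mat_entry (CSym k F) A a b = (\<Sum>vs | mset vs = N. if us = map (imap h) vs then 1 else 0)"
    using M N by (simp add: us_def[symmetric] ent)
  \<comment> \<open>The equation is solved for \<open>vs\<close>, so that the sum collapses to one
    term; the second conjunct records when a solution exists.\<close>
  also have "\<dots> = (\<Sum>vs | mset vs = N. if vs = map (imap g) us \<and> M = image_mset (imap h) N then 1 else 0)"
  proof (intro sum.cong refl)
    fix vs assume "vs \<in> {vs. mset vs = N}"
    then have vs: "mset vs = N" by simp
    have "us = map (imap h) vs" if "vs = map (imap g) us" "M = image_mset (imap h) N"
    proof -
      have "imap h (imap g c) = c" if "c \<in> set us" for c
      proof -
        have "c \<in># mset us" using that by simp
        then have "c \<in># image_mset (imap h) N" using us \<open>M = image_mset (imap h) N\<close> by simp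
        then obtain d where "d \<in># N" "c = imap h d" by auto
        then show ?thesis using inv1 by simp
      qed
      then show ?thesis using that(1) by (simp add: map_idI)
    qed
    moreover have "vs = map (imap g) us \<and> M = image_mset (imap h) N" if "us = map (imap h) vs"
      using that inv[OF vs] us vs by auto
    ultimately show "(if us = map (imap h) vs then 1 else 0) =
        (if vs = map (imap g) us \<and> M = image_mset (imap h) N then 1 else (0::real))" by metis
  qed
  also have "\<dots> = (if M = image_mset (imap h) N then 1 else 0)"
  proof (cases "M = image_mset (imap h) N")
    case True
    \<comment> \<open>The solution has to be a listing of \<open>N\<close> itself, or the sum would
      miss it.\<close>
    have "mset (map (imap g) us) = N"
    proof -
      obtain ws where ws: "mset ws = N" by (metis ex_mset)
      have "mset (map (imap g) us) = mset (map (imap g) (map (imap h) ws))"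
        using us True ws by (simp only: mset_map)
      then show ?thesis using inv[OF ws] ws by (simp only:)
    qed
    then show ?thesis using True by (simp add: finite_listings)
  qed simp
  finally show ?case using M N by simp
next
  case (CPoly k F)
  then obtain M N where M: "a = IdxM M" "size M = k" "set_mset M \<subseteq> basis F m"
    and N: "b = IdxM N" "size N = k" "set_mset N \<subseteq> basis F n" by auto
  define vs where "vs = (SOME vs. mset vs = N)"
  have vs: "mset vs = N" unfolding vs_def by (rule some_listing)
  have ent: "prod_list (map2 (mat_entry F A) us vs) = (if us = map (imap h) vs then 1 else 0)"
    if "mset us = M" for us
  proof (rule prod_list_map2_indicator)
    show "length us = length vs" using vs that M N by (metis size_mset)
    show "mat_entry F A a b = (if a = imap h b then 1 else 0)" if "a \<in> set us" "b \<in> set vs" for a b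
      using that \<open>mset us = M\<close> vs M N by (intro CPoly.IH) auto
  qed
  have "mat_entry (CPoly k F) A a b = (\<Sum>us | mset us = M. if us = map (imap h) vs then 1 else 0)"
    using M N by (simp add: vs_def[symmetric] ent)
  also have "\<dots> = (if M = image_mset (imap h) N then 1 else 0)"
    using vs by (auto simp: finite_listings)
  finally show ?case using M N by simp
qed auto

lemma card_listings:
  "real (card {vs. mset vs = N}) * (\<Prod>a\<in>set_mset N. fact (count N a)) = fact (size N)"
proof -
  have "real (card (permutations_of_multiset N) * (\<Prod>a\<in>set_mset N. fact (count N a))) = real (fact (size N))"
    by (simp only: card_permutations_of_multiset_aux)
  then show ?thesis by (simp add: permutations_of_multiset_def)
qed

text \<open>
  The listings of \<open>M\<close> are distributed evenly over the listings of its image, which turns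
  the multinomial coefficient of \<open>M\<close> into that of the image.
\<close>

lemma card_listings_fibre:
  fixes M :: "'a multiset"
  assumes "mset vs = image_mset g M"
  shows "real (card {us. mset us = M \<and> map g us = vs}) * (\<Prod>a\<in>set_mset M. fact (count M a)) =
    (\<Prod>b\<in>set_mset (image_mset g M). fact (count (image_mset g M) b))"
proof -
  let ?N = "image_mset g M"
  let ?C = "\<lambda>vs. card {us. mset us = M \<and> map g us = vs}"
  \<comment> \<open>Written as a sum of products of indicators, the fibre size falls under
    \<open>sum_listings_perm\<close> and hence does not depend on the order of
    \<open>ws\<close>.\<close>
  have C: "real (?C ws) = (\<Sum>us | mset us = M. prod_list (map2 (\<lambda>b a. if g a = b then 1 else 0) ws us))"
    if "length ws = size M" for ws
  proof -
    have "(\<Sum>us | mset us = M. prod_list (map2 (\<lambda>b a. if g a = b then 1 else 0) ws us)) =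
      (\<Sum>us | mset us = M. if map g us = ws then 1 else (0::real))"
    proof (intro sum.cong refl)
      fix us assume "us \<in> {us. mset us = M}"
      then have "length ws = length us" using that by auto
      then show "prod_list (map2 (\<lambda>b a. if g a = b then 1 else 0) ws us) = (if map g us = ws then 1 else (0::real))"
        by (induction ws us rule: list_induct2) auto
    qed
    also have "\<dots> = real (card ({us. mset us = M} \<inter> {us. map g us = ws}))"
      by (simp add: finite_listings sum.If_cases)
    finally show ?thesis by (simp add: Int_def)
  qed
  have len: "length ws = size M" if "mset ws = ?N" for ws
    using that by (metis size_image_mset size_mset)
  have const: "?C ws = ?C vs" if "mset ws = ?N" for ws
  proof -
    have "real (?C ws) = real (?C vs)"
      using that assms len by (auto simp: C intro!: sum_listings_perm)
    then show ?thesis by simp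
  qed
  have "card {us. mset us = M} = (\<Sum>ws | mset ws = ?N. ?C ws)"
  proof -
    have "(\<Sum>ws | mset ws = ?N. \<Sum>us | us \<in> {us. mset us = M} \<and> map g us = ws. 1) = (\<Sum>us | mset us = M. 1::nat)"
      by (rule sum.group) (auto simp: finite_listings)
    then show ?thesis by simp
  qed
  also have "\<dots> = card {ws. mset ws = ?N} * ?C vs"
    by (simp add: const)
  finally have "real (card {us. mset us = M}) = real (card {ws. mset ws = ?N}) * real (?C vs)"
    by simp
  then have "real (card {ws. mset ws = ?N}) * (real (?C vs) * (\<Prod>a\<in>set_mset M. fact (count M a))) = fact (size M)"
    using card_listings[of M] by (simp add: mult_ac)
  also have "\<dots> = real (card {ws. mset ws = ?N}) * (\<Prod>b\<in>set_mset ?N. fact (count ?N b))"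
    using card_listings[of ?N] by simp
  finally have "real (card {ws. mset ws = ?N}) * (real (?C vs) * (\<Prod>a\<in>set_mset M. fact (count M a))) =
     real (card {ws. mset ws = ?N}) * (\<Prod>b\<in>set_mset ?N. fact (count ?N b))" .
  moreover have "real (card {ws. mset ws = ?N}) \<noteq> 0"
    using card_listings[of ?N] by (metis fact_nonzero mult_zero_left)
  ultimately show ?thesis by simp
qed

text \<open>The adjoint has entries \<open>mat_entry * wt F a / wt F b\<close>, so this is
  coefficient one with the denominator cleared. In a symmetric power the listing of \<open>M\<close>
  is fixed and exactly one listing over it contributes. In a polynomial space the listing of
  \<open>N\<close> is fixed and several listings of \<open>M\<close> may contribute;
  \<open>card_listings_fibre\<close> shows that their number turns the multinomial factor of
  \<open>M\<close> into that of \<open>N\<close>.\<close>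

lemma mat_entry_rho:
  assumes "a \<in> basis F n" "b \<in> basis F m"
  shows "mat_entry F (rho f) a b * wt F a = (if imap f a = b then wt F b else 0)"
  using assms
proof (induction F arbitrary: a b)
  case CId
  then show ?case by (auto simp: rho_def unit_vec_def)
next
  case (CProd F G)
  have IH: "imap f c \<noteq> d \<Longrightarrow> wt F c \<noteq> 0 \<Longrightarrow> mat_entry F (rho f) c d = 0"
    if "c \<in> basis F n" "d \<in> basis F m" for c d
    using CProd.IH(1)[OF that] by simp
  have IH': "imap f c \<noteq> d \<Longrightarrow> wt G c \<noteq> 0 \<Longrightarrow> mat_entry G (rho f) c d = 0"
    if "c \<in> basis G n" "d \<in> basis G m" for c d
    using CProd.IH(2)[OF that] by simp
  show ?case using CProd IH IH' by auto
next
  case (CTensor F G)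
  then obtain a1 a2 b1 b2 where ab: "a = IdxT a1 a2" "a1 \<in> basis F n" "a2 \<in> basis G n"
    "b = IdxT b1 b2" "b1 \<in> basis F m" "b2 \<in> basis G m" by auto
  have "mat_entry (CTensor F G) (rho f) a b * wt (CTensor F G) a =
    (mat_entry F (rho f) a1 b1 * wt F a1) * (mat_entry G (rho f) a2 b2 * wt G a2)"
    using ab by simp
  then show ?case using ab CTensor.IH by simp
next
  case (CSym k F)
  then obtain M N where M: "a = IdxM M" "size M = k" "set_mset M \<subseteq> basis F n"
    and N: "b = IdxM N" "size N = k" "set_mset N \<subseteq> basis F m" by auto
  define us where "us = (SOME us. mset us = M)"
  have us: "mset us = M" unfolding us_def by (rule some_listing)
  have ent: "prod_list (map2 (mat_entry F (rho f)) us vs) * (\<Prod>a\<in>#M. wt F a) =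
      (if map (imap f) us = vs then (\<Prod>b\<in>#N. wt F b) else 0)" if "mset vs = N" for vs
    unfolding us[symmetric] that[symmetric]
  proof (rule prod_list_map2_scaled)
    show "length us = length vs" using us that M N by (metis size_mset)
    show "mat_entry F (rho f) a b * wt F a = (if imap f a = b then wt F b else 0)"
      if "a \<in> set us" "b \<in> set vs" for a b
      using that \<open>mset vs = N\<close> us M N by (intro CSym.IH) auto
  qed
  have "mat_entry (CSym k F) (rho f) a b * wt (CSym k F) a =
      (\<Sum>vs | mset vs = N. if map (imap f) us = vs then (\<Prod>b\<in>#N. wt F b) else 0)"
    using M N by (simp add: us_def[symmetric] sum_distrib_right ent)
  also have "\<dots> = (if image_mset (imap f) M = N then (\<Prod>b\<in>#N. wt F b) else 0)"
    using us by (auto simp: finite_listings)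
  finally show ?case using M N by simp
next
  case (CPoly k F)
  then obtain M N where M: "a = IdxM M" "size M = k" "set_mset M \<subseteq> basis F n"
    and N: "b = IdxM N" "size N = k" "set_mset N \<subseteq> basis F m" by auto
  define vs where "vs = (SOME vs. mset vs = N)"
  have vs: "mset vs = N" unfolding vs_def by (rule some_listing)
  have ent: "prod_list (map2 (mat_entry F (rho f)) us vs) * (\<Prod>a\<in>#M. wt F a) =
      (if map (imap f) us = vs then (\<Prod>b\<in>#N. wt F b) else 0)" if "mset us = M" for us
    unfolding vs[symmetric] that[symmetric]
  proof (rule prod_list_map2_scaled)
    show "length us = length vs" using vs that M N by (metis size_mset)
    show "mat_entry F (rho f) a b * wt F a = (if imap f a = b then wt F b else 0)"
      if "a \<in> set us" "b \<in> set vs" for a b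
      using that \<open>mset us = M\<close> vs M N by (intro CPoly.IH) auto
  qed
  let ?c = "\<lambda>M. (\<Prod>a\<in>set_mset M. fact (count M a)) :: real"
  let ?fib = "{us. mset us = M \<and> map (imap f) us = vs}"
  have "mat_entry (CPoly k F) (rho f) a b * wt (CPoly k F) a =
      ?c M / fact k * (\<Sum>us | mset us = M. prod_list (map2 (mat_entry F (rho f)) us vs) * (\<Prod>a\<in>#M. wt F a))"
    using M N unfolding sum_distrib_right[symmetric] by (simp add: vs_def[symmetric])
  also have "(\<Sum>us | mset us = M. prod_list (map2 (mat_entry F (rho f)) us vs) * (\<Prod>a\<in>#M. wt F a)) =
      (\<Sum>us | mset us = M. if map (imap f) us = vs then (\<Prod>b\<in>#N. wt F b) else 0)"
    by (intro sum.cong) (auto simp: ent)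
  also have "\<dots> = real (card ?fib) * (\<Prod>b\<in>#N. wt F b)"
    by (simp add: finite_listings sum.If_cases Int_def)
  also have "?c M / fact k * \<dots> = (if image_mset (imap f) M = N then ?c N / fact k * (\<Prod>b\<in>#N. wt F b) else 0)"
  proof (cases "image_mset (imap f) M = N")
    case True
    have "real (card ?fib) * ?c M = ?c N"
      using card_listings_fibre[of vs "imap f" M] vs True by simp
    then show ?thesis using True by (simp add: mult_ac)
  next
    case False
    then have "?fib = {}" using vs by auto
    then show ?thesis using False by (metis card.empty mult_zero_left mult_zero_right of_nat_0)
  qed
  finally show ?case using M N by simp
qed


section \<open>The maps between the spaces as pushforwards along labels\<close>

text \<open>Treats \<open>x\<close> as a signed measure on labels. No target dimension occurs: off
  \<open>basis F m\<close> the sum is empty when \<open>f\<close> maps into \<open>[m]\<close>, so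
  identities hold between whole functions.\<close>

definition push :: "construction \<Rightarrow> nat \<Rightarrow> (nat \<Rightarrow> nat) \<Rightarrow> coords \<Rightarrow> coords" where
  "push F n f x = (\<lambda>b. \<Sum>a | a \<in> basis F n \<and> imap f a = b. x a)"

lemma push_cong: "(\<And>i. i \<in> {1..n} \<Longrightarrow> f i = g i) \<Longrightarrow> push F n f x = push F n g x"
  unfolding push_def using imap_cong_basis by (intro ext sum.cong Collect_cong conj_cong) (metis | simp)+

lemma push_eq_0: "f \<in> {1..n} \<rightarrow> {1..m} \<Longrightarrow> b \<notin> basis F m \<Longrightarrow> push F n f x b = 0"
  unfolding push_def using imap_basis by (intro sum.neutral) blast

lemma rho_adj_eq_push:
  assumes "f \<in> {1..n} \<rightarrow> {1..m}"
  shows "rho_adj F m n f x = push F n f x"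
proof
  fix b
  show "rho_adj F m n f x b = push F n f x b"
  proof (cases "b \<in> basis F m")
    case True
    have "wt F b * rho_adj F m n f x b = (\<Sum>a\<in>basis F n. mat_entry F (rho f) a b * wt F a * x a)"
      unfolding rho_adj_def wt_adj[OF True] by (simp add: mult_ac)
    also have "\<dots> = (\<Sum>a\<in>basis F n. if imap f a = b then wt F b * x a else 0)"
      by (intro sum.cong refl) (simp add: mat_entry_rho[OF _ True])
    also have "\<dots> = wt F b * push F n f x b"
      by (simp add: push_def sum.If_cases finite_basis Int_def sum_distrib_left)
    finally show ?thesis using wt_pos[OF True] by simp
  next
    case False
    then show ?thesis using push_eq_0[OF assms] by (simp add: rho_adj_def adj_def)
  qed
qed

lemma apply_map_eq_push:
  assumes "\<And>i j. i \<in> {1..m} \<Longrightarrow> j \<in> {1..n} \<Longrightarrow> A (unit_vec j) i = (if i = h j then 1 else 0)"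
    and "inj_on h {1..n}" "h \<in> {1..n} \<rightarrow> {1..m}"
  shows "apply_map F n m A x = push F n h x"
proof
  fix a
  show "apply_map F n m A x a = push F n h x a"
  proof (cases "a \<in> basis F m")
    case True
    have "apply_map F n m A x a = (\<Sum>b\<in>basis F n. if imap h b = a then x b else 0)"
      using True by (simp add: apply_map_def)
        (intro sum.cong refl, subst mat_entry_injective[where h = h, OF assms(1,2) True], auto)
    then show ?thesis by (simp add: push_def sum.If_cases finite_basis Int_def)
  next
    case False
    then show ?thesis using push_eq_0[OF assms(3)] by (simp add: apply_map_def)
  qed
qed

text \<open>Labels are grouped by their intermediate image; as \<open>f\<close> maps into
  \<open>[m]\<close>, each such image lies in \<open>basis F m\<close>, the range of the outer
  sum.\<close>

lemma push_push:
  assumes "f \<in> {1..n} \<rightarrow> {1..m}"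
  shows "push F m g (push F n f x) = push F n (g \<circ> f) x"
proof
  fix c
  have "push F m g (push F n f x) c =
      (\<Sum>b | b \<in> basis F m \<and> imap g b = c. \<Sum>a | a \<in> {a \<in> basis F n. imap (g \<circ> f) a = c} \<and> imap f a = b. x a)"
    unfolding push_def by (intro sum.cong Collect_cong refl) (auto simp: imap_comp[symmetric])
  also have "\<dots> = push F n (g \<circ> f) x c"
    unfolding push_def using imap_basis[OF _ assms]
    by (intro sum.group) (auto simp: finite_basis imap_comp[symmetric])
  finally show "push F m g (push F n f x) c = push F n (g \<circ> f) x c" .
qed

text \<open>With this map \<open>duplicate n m\<close> is \<open>rho (block n m)\<close>. The shifts
  by one translate between indices counted from 1 and the blocks counted from 0 by
  \<open>div\<close>.\<close>

definition block :: "nat \<Rightarrow> nat \<Rightarrow> nat \<Rightarrow> nat" where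
  "block n m i = (i - 1) div (n div m) + 1"

lemma block_maps: "0 < m \<Longrightarrow> 0 < n \<Longrightarrow> m dvd n \<Longrightarrow> block n m \<in> {1..n} \<rightarrow> {1..m}"
proof
  fix i assume *: "0 < m" "0 < n" "m dvd n" "i \<in> {1..n}"
  then have "i - 1 < m * (n div m)" by auto
  then have "(i - 1) div (n div m) < m" by (simp add: less_mult_imp_div_less)
  then show "block n m i \<in> {1..m}" by (simp add: block_def)
qed

lemma block_fibre:
  assumes "0 < m" "0 < n" "m dvd n" "j \<in> {1..m}"
  shows "card {i \<in> {1..n}. block n m i = j} = n div m"
proof -
  define q where "q = n div m"
  have n: "n = m * q" using assms by (simp add: q_def)
  have q: "0 < q" using n assms by (cases q) auto
  have "{i \<in> {1..n}. block n m i = j} = {(j - 1) * q + 1..j * q}"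
  proof (intro set_eqI iffI)
    fix i assume "i \<in> {i \<in> {1..n}. block n m i = j}"
    then have i: "1 \<le> i" "(i - 1) div q = j - 1" by (auto simp: block_def q_def)
    then have "(j - 1) * q \<le> i - 1" "i - 1 < Suc (j - 1) * q"
      using q by (metis div_times_less_eq_dividend) (use i q in \<open>metis dividend_less_div_times mult_Suc add.commute\<close>)
    moreover have "Suc (j - 1) = j" using assms by simp
    ultimately show "i \<in> {(j - 1) * q + 1..j * q}" using i(1) by auto
  next
    fix i assume i: "i \<in> {(j - 1) * q + 1..j * q}"
    have "(i - 1) div q = j - 1"
    proof (rule div_nat_eqI)
      show "q * (j - 1) \<le> i - 1" using i by (auto simp: mult.commute)
      have "q * Suc (j - 1) = j * q" using assms by (simp add: mult.commute)
      then show "i - 1 < q * Suc (j - 1)" using i by auto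
    qed
    moreover have "j * q \<le> n" using assms n by auto
    ultimately show "i \<in> {i \<in> {1..n}. block n m i = j}" using i assms by (auto simp: block_def q_def)
  qed
  moreover have "j * q - (j - 1) * q = q" using assms by (cases j) auto
  ultimately show ?thesis by (simp add: q_def)
qed

lemma psi_adj_eq_push:
  "0 < m \<Longrightarrow> 0 < n \<Longrightarrow> m dvd n \<Longrightarrow> psi_adj F n m x = push F n (block n m) x"
proof -
  assume *: "0 < m" "0 < n" "m dvd n"
  have "duplicate n m = rho (block n m)" by (auto simp: duplicate_def rho_def block_def)
  then have "psi_adj F n m x = rho_adj F m n (block n m) x"
    by (simp add: psi_adj_def psi_def rho_adj_def)
  then show ?thesis using rho_adj_eq_push[OF block_maps[OF *]] by simp
qed

lemma act_eq_push: "\<sigma> permutes {1..n} \<Longrightarrow> act F n \<sigma> x = push F n \<sigma> x"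
  unfolding act_def
proof (rule apply_map_eq_push)
  assume s: "\<sigma> permutes {1..n}"
  show "\<sigma> \<in> {1..n} \<rightarrow> {1..n}" using permutes_in_image[OF s] by auto
  show "inj_on \<sigma> {1..n}" by (rule permutes_inj_on[OF s])
  show "perm_act \<sigma> (unit_vec j) i = (if i = \<sigma> j then 1 else 0)" for i j
    using permutes_inverses[OF s] by (auto simp: perm_act_def unit_vec_def)
qed

lemma phi_eq_push: "n \<le> N \<Longrightarrow> phi F N n x = push F n id x"
  unfolding phi_def by (rule apply_map_eq_push) (auto simp: zero_pad_def unit_vec_def)


section \<open>Uniformly random maps between finite sets\<close>

text \<open>The complements of \<open>S\<close> and of its image have equal size, so any bijection
  between them completes \<open>h\<close>.\<close>

lemma extend_to_permutation:
  assumes "finite A" "S \<subseteq> A" "h ` S \<subseteq> A" "inj_on h S"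
  obtains p where "p permutes A" "\<And>x. x \<in> S \<Longrightarrow> p x = h x"
proof -
  have "card (A - S) = card (A - h ` S)"
    using assms by (simp add: card_Diff_subset card_image finite_subset)
  then obtain k where k: "bij_betw k (A - S) (A - h ` S)"
    using assms(1) by (meson finite_Diff finite_same_card_bij)
  define p where "p x = (if x \<in> S then h x else if x \<in> A then k x else x)" for x
  have "bij_betw p (S \<union> (A - S)) (h ` S \<union> (A - h ` S))"
  proof (rule bij_betw_combine)
    show "bij_betw p S (h ` S)"
      using assms(4) by (simp add: p_def bij_betw_def inj_on_def)
    show "bij_betw p (A - S) (A - h ` S)"
      using k by (rule bij_betw_cong[THEN iffD1, rotated]) (simp add: p_def)
  qed auto
  then have "bij_betw p A A" using assms by (simp add: Un_absorb1)
  then have "p permutes A" by (rule bij_imp_permutes) (use assms(2) in \<open>auto simp: p_def\<close>)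
  then show ?thesis using that by (simp add: p_def)
qed

lemma sum_equal_fibres:
  fixes h :: "'b \<Rightarrow> 'c::semiring_1"
  assumes "finite A" "finite B" "T \<in> A \<rightarrow> B" "\<And>b. b \<in> B \<Longrightarrow> card {a \<in> A. T a = b} = c"
  shows "(\<Sum>a\<in>A. h (T a)) = of_nat c * (\<Sum>b\<in>B. h b)"
proof -
  have "(\<Sum>a\<in>A. h (T a)) = (\<Sum>b\<in>B. \<Sum>a | a \<in> A \<and> T a = b. h (T a))"
    using assms by (intro sum.group[symmetric]) auto
  also have "\<dots> = (\<Sum>b\<in>B. of_nat c * h b)"
    using assms(4) by (intro sum.cong) auto
  finally show ?thesis by (simp add: sum_distrib_left)
qed

lemma card_equal_fibres:
  assumes "finite A" "finite B" "T \<in> A \<rightarrow> B" "\<And>b. b \<in> B \<Longrightarrow> card {a \<in> A. T a = b} = c"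
  shows "card A = c * card B"
  using sum_equal_fibres[OF assms, of "\<lambda>_. 1::nat"] by simp

text \<open>In terms of probability, \<open>T\<close> turns a uniform element of \<open>A\<close>
  into a uniform element of \<open>B\<close>. The fibre size cancels; it is nonzero because
  \<open>A\<close> is nonempty.\<close>

lemma average_equal_fibres:
  fixes h :: "'b \<Rightarrow> real"
  assumes "finite A" "A \<noteq> {}" "finite B" "T \<in> A \<rightarrow> B" "\<And>b. b \<in> B \<Longrightarrow> card {a \<in> A. T a = b} = c"
  shows "(\<Sum>a\<in>A. h (T a)) / card A = (\<Sum>b\<in>B. h b) / card B"
proof -
  have "card A \<noteq> 0" using assms by simp
  then have "c \<noteq> 0" using card_equal_fibres[OF assms(1,3,4,5)] by auto
  then show ?thesis
    using sum_equal_fibres[OF assms(1,3,4,5), of h] card_equal_fibres[OF assms(1,3,4,5)] by simp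
qed

lemma ennreal_average_equal_fibres:
  fixes h :: "'b \<Rightarrow> ennreal"
  assumes "finite A" "A \<noteq> {}" "finite B" "T \<in> A \<rightarrow> B" "\<And>b. b \<in> B \<Longrightarrow> card {a \<in> A. T a = b} = c"
  shows "ennreal (1 / card A) * (\<Sum>a\<in>A. h (T a)) = ennreal (1 / card B) * (\<Sum>b\<in>B. h b)"
proof -
  have "card A \<noteq> 0" using assms by simp
  then have c: "c \<noteq> 0" using card_equal_fibres[OF assms(1,3,4,5)] by auto
  have "ennreal (1 / card A) * (\<Sum>a\<in>A. h (T a)) = (ennreal (1 / card A) * ennreal (real c)) * (\<Sum>b\<in>B. h b)"
    using sum_equal_fibres[OF assms(1,3,4,5), of h] by (simp add: mult.assoc ennreal_of_nat_eq_real_of_nat)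
  also have "ennreal (1 / card A) * ennreal (real c) = ennreal (1 / card B)"
    using c card_equal_fibres[OF assms(1,3,4,5)] by (simp add: ennreal_mult[symmetric])
  finally show ?thesis .
qed

text \<open>Extensional functions make the set finite. The price is a \<open>restrict\<close> around
  compositions, which \<open>push_cong\<close> and \<open>imap_cong_basis\<close> do not
  see.\<close>

abbreviation maps :: "nat \<Rightarrow> nat \<Rightarrow> (nat \<Rightarrow> nat) set" where
  "maps n m \<equiv> {1..n} \<rightarrow>\<^sub>E {1..m}"

lemma finite_maps: "finite (maps n m)"
  by (intro finite_PiE) auto

lemma maps_nonempty: "0 < m \<Longrightarrow> maps n m \<noteq> {}"
  by (simp add: PiE_eq_empty_iff)

lemma card_maps: "card (maps n m) = m ^ n"
  by (simp add: card_funcsetE)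

text \<open>The values \<open>h i\<close> are chosen independently, each in the fibre of
  \<open>g\<close> over \<open>f i\<close>.\<close>

lemma fibre_postcompose:
  assumes "\<And>j. j \<in> {1..m} \<Longrightarrow> card {i \<in> {1..n}. g i = j} = q" "f \<in> maps k m"
  shows "card {h \<in> maps k n. restrict (g \<circ> h) {1..k} = f} = q ^ k"
proof -
  have "{h \<in> maps k n. restrict (g \<circ> h) {1..k} = f} = (\<Pi>\<^sub>E i\<in>{1..k}. {j \<in> {1..n}. g j = f i})"
  proof (intro set_eqI iffI)
    fix h assume h: "h \<in> {h \<in> maps k n. restrict (g \<circ> h) {1..k} = f}"
    have "g (h i) = f i" if "i \<in> {1..k}" for i using h that by auto
    then show "h \<in> (\<Pi>\<^sub>E i\<in>{1..k}. {j \<in> {1..n}. g j = f i})" using h by (auto simp: PiE_iff)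
  next
    fix h assume h: "h \<in> (\<Pi>\<^sub>E i\<in>{1..k}. {j \<in> {1..n}. g j = f i})"
    then have "restrict (g \<circ> h) {1..k} = f"
      using assms(2) by (intro ext) (auto simp: PiE_iff extensional_def)
    then show "h \<in> {h \<in> maps k n. restrict (g \<circ> h) {1..k} = f}" using h by (auto simp: PiE_iff)
  qed
  moreover have "(\<Prod>i = 1..k. card {j \<in> {1..n}. g j = f i}) = (\<Prod>i = 1..k. q)"
    using assms by (intro prod.cong refl) (auto simp: PiE_iff)
  ultimately show ?thesis by (simp add: card_PiE)
qed

text \<open>The values of \<open>g\<close> are forced on the image of \<open>h\<close> and free at
  the other \<open>N - n\<close> points; \<open>T\<close> below lists the choices at each
  point.\<close>

lemma fibre_precompose:
  assumes "inj_on h {1..n}" "h ` {1..n} \<subseteq> {1..N}" "f \<in> maps n m"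
  shows "card {g \<in> maps N m. restrict (g \<circ> h) {1..n} = f} = m ^ (N - n)"
proof -
  define r where "r = the_inv_into {1..n} h"
  have r: "r (h i) = i" if "i \<in> {1..n}" for i
    using the_inv_into_f_f[OF assms(1) that] by (simp add: r_def)
  define T where "T j = (if j \<in> h ` {1..n} then {f (r j)} else {1..m})" for j
  have T: "T (h i) = {f i}" if "i \<in> {1..n}" for i using r that by (auto simp: T_def)
  have "{g \<in> maps N m. restrict (g \<circ> h) {1..n} = f} = PiE {1..N} T"
  proof (intro set_eqI iffI)
    fix g assume g: "g \<in> {g \<in> maps N m. restrict (g \<circ> h) {1..n} = f}"
    have gh: "g (h i) = f i" if "i \<in> {1..n}" for i using g that by auto
    have "g j \<in> T j" if "j \<in> {1..N}" for j
    proof (cases "j \<in> h ` {1..n}")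
      case True
      then obtain i where "i \<in> {1..n}" "j = h i" by blast
      then show ?thesis using gh T by simp
    next
      case False
      then show ?thesis using g that by (auto simp: T_def PiE_iff)
    qed
    then show "g \<in> PiE {1..N} T" using g by (simp add: PiE_iff)
  next
    fix g assume g: "g \<in> PiE {1..N} T"
    have "T j \<subseteq> {1..m}" for j
      using r assms(3) by (auto simp: T_def PiE_iff)
    then have "g \<in> maps N m" using g by (meson PiE_mono subsetD)
    moreover have "g (h i) = f i" if "i \<in> {1..n}" for i
    proof -
      have "h i \<in> {1..N}" using assms(2) that by blast
      then have "g (h i) \<in> T (h i)" by (rule PiE_mem[OF g])
      then show ?thesis using T[OF that] by simp
    qed
    then have "restrict (g \<circ> h) {1..n} = f"
      using assms(3) by (intro ext) (auto simp: PiE_iff extensional_def)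
    ultimately show "g \<in> {g \<in> maps N m. restrict (g \<circ> h) {1..n} = f}" by simp
  qed
  then have "card {g \<in> maps N m. restrict (g \<circ> h) {1..n} = f} = (\<Prod>j = 1..N. card (T j))"
    by (simp only: card_PiE finite_atLeastAtMost)
  also have "\<dots> = (\<Prod>j = 1..N. if j \<in> h ` {1..n} then 1 else m)"
    by (intro prod.cong refl) (auto simp: T_def)
  also have "\<dots> = m ^ card ({1..N} - h ` {1..n})"
    by (simp add: prod.If_cases Diff_eq)
  also have "card ({1..N} - h ` {1..n}) = N - n"
    using assms by (simp add: card_Diff_subset card_image)
  finally show ?thesis .
qed

section \<open>Fibre sizes and collisions of a random map\<close>

lemma average_maps_pair:
  fixes u v :: "nat \<Rightarrow> real"
  assumes "i \<in> {1..n}" "k \<in> {1..n}" "i \<noteq> k" "0 < m"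
  shows "(\<Sum>f\<in>maps n m. u (f i) * v (f k)) / card (maps n m) =
    ((\<Sum>y = 1..m. u y) / m) * ((\<Sum>y = 1..m. v y) / m)"
proof -
  \<comment> \<open>Factors one at all other points turn the summand into a product over
    \<open>[n]\<close>, which exchanges with the sum over maps; this is the independence of the
    values of a random map.\<close>
  let ?w = "\<lambda>j y. (if j = i then u y else 1) * (if j = k then v y else 1)"
  have "(\<Sum>f\<in>maps n m. u (f i) * v (f k)) = (\<Sum>f\<in>maps n m. \<Prod>j\<in>{1..n}. ?w j (f j))"
    using assms by (simp add: prod.distrib)
  also have "\<dots> = (\<Prod>j\<in>{1..n}. \<Sum>y\<in>{1..m}. ?w j y)"
    by (rule prod_sum_PiE[symmetric]) auto
  also have "\<dots> = (\<Prod>j\<in>{1..n}. real m * ((if j = i then (\<Sum>y = 1..m. u y) / m else 1) *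
      (if j = k then (\<Sum>y = 1..m. v y) / m else 1)))"
    using assms by (intro prod.cong refl) auto
  also have "\<dots> = real m ^ n * (((\<Sum>y = 1..m. u y) / m) * ((\<Sum>y = 1..m. v y) / m))"
    using assms by (simp add: prod.distrib)
  finally show ?thesis using assms unfolding card_maps by simp
qed

lemma average_maps_single:
  fixes u :: "nat \<Rightarrow> real"
  assumes "i \<in> {1..n}" "0 < m"
  shows "(\<Sum>f\<in>maps n m. u (f i)) / card (maps n m) = (\<Sum>y = 1..m. u y) / m"
proof -
  let ?w = "\<lambda>j y. (if j = i then u y else 1)"
  have "(\<Sum>f\<in>maps n m. u (f i)) = (\<Sum>f\<in>maps n m. \<Prod>j\<in>{1..n}. ?w j (f j))"
    using assms by simp
  also have "\<dots> = (\<Prod>j\<in>{1..n}. \<Sum>y\<in>{1..m}. ?w j y)"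
    by (rule prod_sum_PiE[symmetric]) auto
  also have "\<dots> = (\<Prod>j\<in>{1..n}. real m * (if j = i then (\<Sum>y = 1..m. u y) / m else 1))"
    using assms by (intro prod.cong refl) auto
  also have "\<dots> = real m ^ n * ((\<Sum>y = 1..m. u y) / m)"
    using assms by (simp add: prod.distrib)
  finally show ?thesis using assms unfolding card_maps by simp
qed

text \<open>Cauchy-Schwarz against the constant function one.\<close>

lemma average_le_sqrt_average_square:
  fixes u :: "'a \<Rightarrow> real"
  assumes "finite A" "A \<noteq> {}"
  shows "(\<Sum>a\<in>A. \<bar>u a\<bar>) / card A \<le> sqrt ((\<Sum>a\<in>A. (u a)\<^sup>2) / card A)"
proof (rule real_le_rsqrt)
  have c: "0 < real (card A)" using assms by (simp add: card_gt_0_iff)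
  have "(\<Sum>a\<in>A. \<bar>u a\<bar>)\<^sup>2 \<le> (\<Sum>a\<in>A. (u a)\<^sup>2) * card A"
    using sum_squared_le_sum_of_squares[of "\<lambda>a. \<bar>u a\<bar>" A] by simp
  then show "((\<Sum>a\<in>A. \<bar>u a\<bar>) / card A)\<^sup>2 \<le> (\<Sum>a\<in>A. (u a)\<^sup>2) / card A"
    using c by (simp add: power_divide power2_eq_square field_simps)
qed

text \<open>The fibre size is binomial with parameters \<open>n\<close> and \<open>1 / m\<close>. It
  is centred as a sum of the values \<open>g (f i)\<close>, where \<open>g\<close> has mean zero, so
  independence kills the off-diagonal terms of the square.\<close>

lemma variance_fibre_size:
  assumes "j \<in> {1..m}"
  shows "(\<Sum>f\<in>maps n m. (real (card {i \<in> {1..n}. f i = j}) - n / m)\<^sup>2) / card (maps n m)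
    = n * (real m - 1) / (real m)\<^sup>2"
proof -
  have m: "0 < m" using assms by auto
  define g where "g y = (if y = j then 1 else 0) - 1 / real m" for y
  have g0: "(\<Sum>y = 1..m. g y) = 0" using assms by (simp add: g_def sum_subtractf)
  have "(\<Sum>y = 1..m. g y * g y) = (\<Sum>y = 1..m. (if y = j then 1 - 2 / real m else 0) + 1 / (real m)\<^sup>2)"
    by (intro sum.cong refl) (auto simp: g_def power2_eq_square algebra_simps)
  also have "\<dots> = (real m - 1) / m"
    using assms by (simp add: sum.distrib) (simp add: power2_eq_square field_simps)
  finally have g2: "(\<Sum>y = 1..m. g y * g y) = (real m - 1) / m" .
  have sq: "(real (card {i \<in> {1..n}. f i = j}) - n / m)\<^sup>2 = (\<Sum>i = 1..n. \<Sum>k = 1..n. g (f i) * g (f k))" for f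
  proof -
    have "real (card {i \<in> {1..n}. f i = j}) - n / m = (\<Sum>i = 1..n. g (f i))"
      by (simp add: g_def sum_subtractf sum.If_cases Int_def)
    then show ?thesis by (simp add: power2_eq_square sum_product)
  qed
  have cov: "(\<Sum>f\<in>maps n m. g (f i) * g (f k)) / card (maps n m) = (if i = k then (real m - 1) / (real m)\<^sup>2 else 0)"
    if "i \<in> {1..n}" "k \<in> {1..n}" for i k
  proof (cases "i = k")
    case True
    then show ?thesis
      using average_maps_single[OF that(1) m, of "\<lambda>y. g y * g y"] g2 by (simp add: power2_eq_square)
  next
    case False
    then show ?thesis using average_maps_pair[OF that False m, of g g] g0 by simp
  qed
  have "(\<Sum>f\<in>maps n m. (real (card {i \<in> {1..n}. f i = j}) - n / m)\<^sup>2) / card (maps n m) =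
      (\<Sum>i = 1..n. \<Sum>k = 1..n. (\<Sum>f\<in>maps n m. g (f i) * g (f k)) / card (maps n m))"
  proof -
    have "(\<Sum>f\<in>maps n m. \<Sum>i = 1..n. \<Sum>k = 1..n. g (f i) * g (f k)) =
        (\<Sum>i = 1..n. \<Sum>f\<in>maps n m. \<Sum>k = 1..n. g (f i) * g (f k))"
      by (rule sum.swap)
    also have "\<dots> = (\<Sum>i = 1..n. \<Sum>k = 1..n. \<Sum>f\<in>maps n m. g (f i) * g (f k))"
      by (intro sum.cong refl sum.swap)
    finally show ?thesis unfolding sq sum_divide_distrib[symmetric] by (simp only:)
  qed
  also have "\<dots> = (\<Sum>i = 1..n. \<Sum>k = 1..n. if i = k then (real m - 1) / (real m)\<^sup>2 else 0)"
    by (intro sum.cong refl cov)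
  finally show ?thesis by simp
qed

text \<open>Each of the \<open>m\<close> fibres contributes at most its standard deviation
  \<open>sqrt (n * (m - 1)) / m\<close>.\<close>

lemma average_fibre_deviation:
  assumes "0 < m"
  shows "(\<Sum>f\<in>maps n m. \<Sum>j = 1..m. \<bar>real (card {i \<in> {1..n}. f i = j}) - n / m\<bar>) / card (maps n m)
    \<le> sqrt (n * (real m - 1))"
proof -
  have "(\<Sum>f\<in>maps n m. \<Sum>j = 1..m. \<bar>real (card {i \<in> {1..n}. f i = j}) - n / m\<bar>) / card (maps n m) =
      (\<Sum>j = 1..m. (\<Sum>f\<in>maps n m. \<bar>real (card {i \<in> {1..n}. f i = j}) - n / m\<bar>) / card (maps n m))"
    unfolding sum_divide_distrib[symmetric] by (subst sum.swap) simp
  also have "\<dots> \<le> (\<Sum>j = 1..m. sqrt (n * (real m - 1) / (real m)\<^sup>2))"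
  proof (intro sum_mono)
    fix j assume j: "j \<in> {1..m}"
    show "(\<Sum>f\<in>maps n m. \<bar>real (card {i \<in> {1..n}. f i = j}) - n / m\<bar>) / card (maps n m)
        \<le> sqrt (n * (real m - 1) / (real m)\<^sup>2)"
      unfolding variance_fibre_size[OF j, symmetric]
      by (rule average_le_sqrt_average_square[OF finite_maps maps_nonempty[OF assms]])
  qed
  also have "\<dots> = sqrt (n * (real m - 1))"
    using assms by (simp add: real_sqrt_divide)
  finally show ?thesis .
qed

text \<open>
  Each fibre of \<open>f\<close> of size \<open>N\<close> has \<open>min N (n div m)\<close> points that inject into the corresponding fibre
  of \<open>g\<close>; extend the union of these injections to a permutation.
\<close>

lemma near_equidistributed_permutation:
  fixes f g :: "nat \<Rightarrow> nat"
  assumes "f \<in> {1..n} \<rightarrow> {1..m}" "0 < m" "m dvd n"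
    and "\<And>j. j \<in> {1..m} \<Longrightarrow> card {i \<in> {1..n}. g i = j} = n div m"
  obtains p where "p permutes {1..n}"
    "real (card {i \<in> {1..n}. g (p i) \<noteq> f i}) \<le> (\<Sum>j = 1..m. \<bar>real (card {i \<in> {1..n}. f i = j}) - n / m\<bar>)"
proof -
  define q where "q = n div m"
  have n: "n = m * q" using assms by (simp add: q_def)
  let ?N = "\<lambda>j. card {i \<in> {1..n}. f i = j}"
  let ?P = "\<lambda>j S h. S \<subseteq> {i \<in> {1..n}. f i = j} \<and> card S = min (?N j) q \<and> inj_on h S \<and>
    h ` S \<subseteq> {i \<in> {1..n}. g i = j}"
  have ex: "\<exists>w. ?P j (fst w) (snd w)"
    if j: "j \<in> {1..m}" for j
  proof -
    obtain S where S: "S \<subseteq> {i \<in> {1..n}. f i = j}" "card S = min (?N j) q"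
      by (meson min.cobounded1 obtain_subset_with_card_n)
    moreover have "finite S" using S(1) by (rule finite_subset) auto
    moreover have "card S \<le> card {i \<in> {1..n}. g i = j}" using S(2) assms(4)[OF j] by (simp add: q_def)
    ultimately obtain h where "h ` S \<subseteq> {i \<in> {1..n}. g i = j}" "inj_on h S"
      using card_le_inj[of S "{i \<in> {1..n}. g i = j}"] by auto
    then show ?thesis using S by (intro exI[of _ "(S, h)"]) simp
  qed
  have "\<exists>w. \<forall>j\<in>{1..m}. ?P j (fst (w j)) (snd (w j))"
    by (intro bchoice ballI ex)
  then obtain w where w: "\<And>j. j \<in> {1..m} \<Longrightarrow> ?P j (fst (w j)) (snd (w j))" by blast
  define S h where "S = fst \<circ> w" and "h = snd \<circ> w"
  have Sh: "?P j (S j) (h j)" if "j \<in> {1..m}" for j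
    using w[OF that] by (simp add: S_def h_def)
  define U where "U = (\<Union>j\<in>{1..m}. S j)"
  define k where "k i = h (f i) i" for i
  have U: "f i \<in> {1..m}" "i \<in> S (f i)" "i \<in> {1..n}" if "i \<in> U" for i
    using that Sh unfolding U_def by blast+
  have k: "k i \<in> {1..n}" "g (k i) = f i" if "i \<in> U" for i
    using Sh[OF U(1)[OF that]] U(2)[OF that] unfolding k_def by blast+
  \<comment> \<open>Within one fibre of \<open>f\<close> this is injectivity of the chosen
    \<open>h\<close>; points of different fibres stay apart because
    \<open>g (k i) = f i\<close>.\<close>
  have "inj_on k U"
  proof (rule inj_onI)
    fix i i' assume i: "i \<in> U" "i' \<in> U" "k i = k i'"
    then have "f i = f i'" using k(2) by metis
    then show "i = i'" using i U Sh[OF U(1)[OF i(1)]] unfolding k_def by (metis inj_onD)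
  qed
  moreover have "k ` U \<subseteq> {1..n}" "U \<subseteq> {1..n}" using k U by blast+
  ultimately obtain p where p: "p permutes {1..n}" "\<And>i. i \<in> U \<Longrightarrow> p i = k i"
    using extend_to_permutation[of "{1..n}" U k] by blast
  have "card U = (\<Sum>j = 1..m. card (S j))"
    unfolding U_def
  proof (rule card_UN_disjoint)
    show "\<forall>j\<in>{1..m}. finite (S j)"
    proof
      fix j assume "j \<in> {1..m}"
      then have "S j \<subseteq> {i \<in> {1..n}. f i = j}" using Sh by blast
      then show "finite (S j)" by (rule finite_subset) simp
    qed
    show "\<forall>i\<in>{1..m}. \<forall>j\<in>{1..m}. i \<noteq> j \<longrightarrow> S i \<inter> S j = {}" using Sh by blast
  qed auto
  also have "\<dots> = (\<Sum>j = 1..m. min (?N j) q)" using Sh by simp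
  finally have cU: "real (card U) = (\<Sum>j = 1..m. real (min (?N j) q))" by simp
  have "{i \<in> {1..n}. g (p i) \<noteq> f i} \<subseteq> {1..n} - U" using p(2) k(2) by auto
  then have "card {i \<in> {1..n}. g (p i) \<noteq> f i} \<le> card ({1..n} - U)"
    by (intro card_mono) auto
  also have "\<dots> = n - card U" using \<open>U \<subseteq> {1..n}\<close> by (simp add: card_Diff_subset finite_subset)
  finally have "real (card {i \<in> {1..n}. g (p i) \<noteq> f i}) \<le> real n - real (card U)"
    using card_mono[OF _ \<open>U \<subseteq> {1..n}\<close>] by simp
  also have "\<dots> = (\<Sum>j = 1..m. real q - real (min (?N j) q))"
    unfolding cU sum_subtractf by (simp add: n)
  \<comment> \<open>Each summand is the shortfall of a fibre of \<open>f\<close> below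
    \<open>q = n / m\<close>, and so at most its deviation from \<open>q\<close>.\<close>
  also have "\<dots> \<le> (\<Sum>j = 1..m. \<bar>real (?N j) - n / m\<bar>)"
    using assms(2) by (intro sum_mono) (auto simp: n min_def)
  finally show ?thesis using that p by blast
qed

text \<open>Union bound over ordered pairs of distinct points of \<open>S\<close>, each colliding
  with probability \<open>1 / n\<close>. The value 2 costs nothing, since a collision of
  \<open>i\<close> and \<open>k\<close> is counted both as \<open>(i, k)\<close> and as
  \<open>(k, i)\<close>.\<close>

lemma average_not_inj:
  assumes "S \<subseteq> {1..n}"
  shows "(\<Sum>f\<in>maps n n. if inj_on f S then 0 else 2) / card (maps n n)
    \<le> real (card S) * (real (card S) - 1) / n"
proof (cases "n = 0")
  case True
  then show ?thesis using assms by simp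
next
  case False
  let ?P = "SIGMA i:S. S - {i}"
  have fin: "finite S" using assms finite_subset by blast
  have pair: "(\<Sum>f\<in>maps n n. if f i = f k then 1 else 0) / card (maps n n) = 1 / real n"
    if "(i, k) \<in> ?P" for i k
  proof -
    \<comment> \<open>The collision is split by its common value \<open>c\<close>, which brings it
      into the product form of \<open>average_maps_pair\<close>.\<close>
    have "(\<Sum>f\<in>maps n n. if f i = f k then 1 else (0::real)) =
        (\<Sum>f\<in>maps n n. \<Sum>c = 1..n. (if f i = c then 1 else 0) * (if f k = c then 1 else 0))"
    proof (intro sum.cong refl)
      fix f assume "f \<in> maps n n"
      then have "f i \<in> {1..n}" using that assms by (auto simp: PiE_iff)
      then show "(if f i = f k then 1 else (0::real)) =
          (\<Sum>c = 1..n. (if f i = c then 1 else 0) * (if f k = c then 1 else 0))"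
        by (subst sum.cong[OF refl, where h = "\<lambda>c. if c = f i then (if f i = f k then 1 else 0) else 0"]) auto
    qed
    then have "(\<Sum>f\<in>maps n n. if f i = f k then 1 else 0) / card (maps n n) = 
        (\<Sum>c = 1..n. (\<Sum>f\<in>maps n n. (if f i = c then 1 else 0) * (if f k = c then 1 else 0)) / real (card (maps n n)))"
      by (subst (asm) sum.swap) (simp add: sum_divide_distrib)
    also have "\<dots> = (\<Sum>c = 1..n. (1 / n) * (1 / n))"
    proof (intro sum.cong refl)
      fix c assume "c \<in> {1..n}"
      then show "(\<Sum>f\<in>maps n n. (if f i = c then 1 else 0) * (if f k = c then 1 else 0)) / real (card (maps n n)) = (1 / n) * (1 / n)"
        using that assms False
        by (subst average_maps_pair[of i n k n "\<lambda>y. if y = c then 1 else 0" "\<lambda>y. if y = c then 1 else 0"]) auto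
    qed
    finally show ?thesis using False by simp
  qed
  have "(\<Sum>f\<in>maps n n. if inj_on f S then 0 else 2) \<le> (\<Sum>f\<in>maps n n. \<Sum>(i, k)\<in>?P. if f i = f k then 1 else (0::real))"
  proof (intro sum_mono)
    fix f
    show "(if inj_on f S then 0 else 2) \<le> (\<Sum>(i, k)\<in>?P. if f i = f k then 1 else (0::real))"
    proof (cases "inj_on f S")
      case True
      then show ?thesis by (simp add: sum_nonneg case_prod_beta)
    next
      case notinj: False
      then obtain i k where ik: "i \<in> S" "k \<in> S" "i \<noteq> k" "f i = f k" by (auto simp: inj_on_def)
      have "(2::real) = (\<Sum>(i, k)\<in>{(i, k), (k, i)}. if f i = f k then 1 else 0)" using ik by simp
      also have "\<dots> \<le> (\<Sum>(i, k)\<in>?P. if f i = f k then 1 else (0::real))"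
        using ik fin by (intro sum_mono2) (auto split: if_splits)
      finally show ?thesis using notinj by simp
    qed
  qed
  also have "\<dots> = (\<Sum>(i, k)\<in>?P. \<Sum>f\<in>maps n n. if f i = f k then 1 else (0::real))"
    by (subst sum.swap) (simp add: case_prod_beta)
  finally have "(\<Sum>f\<in>maps n n. if inj_on f S then 0 else 2) / card (maps n n) \<le>
      (\<Sum>(i, k)\<in>?P. (\<Sum>f\<in>maps n n. if f i = f k then 1 else (0::real)) / card (maps n n))"
    by (simp add: divide_right_mono sum_divide_distrib[symmetric] case_prod_beta)
  also have "\<dots> = (\<Sum>(i, k)\<in>?P. 1 / real n)"
    by (intro sum.cong refl) (use pair in \<open>auto\<close>)
  also have "\<dots> = real (card ?P) / n" by (simp add: case_prod_beta)
  also have "card ?P = (\<Sum>i\<in>S. card S - 1)"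
    using fin by (subst card_SigmaI) auto
  also have "real (\<Sum>i\<in>S. card S - 1) = real (card S) * (real (card S) - 1)"
    using fin by (cases "S = {}") (auto simp: of_nat_diff card_gt_0_iff Suc_le_eq)
  finally show ?thesis .
qed


section \<open>Laws of randomly relabelled vectors\<close>

lemma coordinate_measurable: "(\<lambda>x::coords. x a) \<in> borel_measurable borel"
  by (intro borel_measurable_continuous_onI) simp

lemma push_measurable: "push F n f \<in> measurable borel borel"
  unfolding push_def
  by (intro borel_measurable_continuous_onI continuous_on_coordinatewise_then_product continuous_on_sum) simp

text \<open>Compact sets are closed because the product topology is Hausdorff. This makes each set
  of the family an event.\<close>

lemma compact_coords_measurable:
  assumes "compact (S :: coords set)"
  shows "S \<in> sets borel"
proof -
  have "Hausdorff_space (euclidean :: coords topology)"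
    by (subst euclidean_product_topology[symmetric]) (simp add: Hausdorff_space_product_topology)
  then have "closed S"
    using assms compactin_imp_closedin[of euclidean S] by simp
  then show ?thesis by simp
qed

section \<open>Mixtures over a uniformly chosen parameter\<close>

lemma measurable_uniform_pair:
  assumes "finite A" "\<And>a. a \<in> A \<Longrightarrow> g a \<in> measurable \<mu> N"
  shows "(\<lambda>(a, x). g a x) \<in> measurable (uniform_count_measure A \<Otimes>\<^sub>M \<mu>) N"
proof -
  have "(\<lambda>(a, x). g a x) \<in> measurable (count_space A \<Otimes>\<^sub>M \<mu>) N"
    using assms by (intro measurable_pair_measure_countable1) (auto simp: countable_finite)
  moreover have "sets (uniform_count_measure A \<Otimes>\<^sub>M \<mu>) = sets (count_space A \<Otimes>\<^sub>M \<mu>)"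
    by (intro sets_pair_measure_cong) (simp_all add: sets_uniform_count_measure)
  ultimately show ?thesis using measurable_cong_sets by blast
qed

lemma nn_integral_uniform_pair:
  assumes "finite A" "sigma_finite_measure \<mu>" "\<And>a. a \<in> A \<Longrightarrow> g a \<in> measurable \<mu> N" "h \<in> borel_measurable N"
  shows "(\<integral>\<^sup>+ y. h y \<partial>distr (uniform_count_measure A \<Otimes>\<^sub>M \<mu>) N (\<lambda>(a, x). g a x)) =
    ennreal (1 / card A) * (\<Sum>a\<in>A. \<integral>\<^sup>+ x. h (g a x) \<partial>\<mu>)"
proof -
  note meas = measurable_uniform_pair[OF assms(1,3)]
  have hm: "(\<lambda>p. h ((\<lambda>(a, x). g a x) p)) \<in> borel_measurable (uniform_count_measure A \<Otimes>\<^sub>M \<mu>)"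
    by (rule measurable_compose[OF meas assms(4)])
  have "(\<integral>\<^sup>+ y. h y \<partial>distr (uniform_count_measure A \<Otimes>\<^sub>M \<mu>) N (\<lambda>(a, x). g a x)) =
      (\<integral>\<^sup>+ p. h ((\<lambda>(a, x). g a x) p) \<partial>(uniform_count_measure A \<Otimes>\<^sub>M \<mu>))"
    using assms(4) by (subst nn_integral_distr[OF meas]) simp_all
  also have "\<dots> = (\<integral>\<^sup>+ a. \<integral>\<^sup>+ x. h (g a x) \<partial>\<mu> \<partial>uniform_count_measure A)"
    using sigma_finite_measure.nn_integral_fst[OF assms(2) hm] by simp
  also have "\<dots> = (\<Sum>a\<in>A. ennreal (1 / card A) * (\<integral>\<^sup>+ x. h (g a x) \<partial>\<mu>))"
    unfolding uniform_count_measure_def by (rule nn_integral_point_measure_finite[OF assms(1)])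
  finally show ?thesis by (simp add: sum_distrib_left)
qed

lemma emeasure_uniform_pair:
  assumes "finite A" "sigma_finite_measure \<mu>" "\<And>a. a \<in> A \<Longrightarrow> g a \<in> measurable \<mu> N" "B \<in> sets N"
  shows "emeasure (distr (uniform_count_measure A \<Otimes>\<^sub>M \<mu>) N (\<lambda>(a, x). g a x)) B =
    ennreal (1 / card A) * (\<Sum>a\<in>A. emeasure (distr \<mu> N (g a)) B)"
proof -
  have "(\<integral>\<^sup>+ x. indicator B (g a x) \<partial>\<mu>) = emeasure (distr \<mu> N (g a)) B" if "a \<in> A" for a
  proof -
    have "(\<integral>\<^sup>+ x. indicator B (g a x) \<partial>\<mu>) = (\<integral>\<^sup>+ y. indicator B y \<partial>distr \<mu> N (g a))"
      using assms(3)[OF that] assms(4) by (subst nn_integral_distr) auto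
    then show ?thesis using assms(4) by simp
  qed
  then show ?thesis
    using nn_integral_uniform_pair[OF assms(1-3), where h = "indicator B"] assms(4) by simp
qed

lemma integral_uniform_pair:
  fixes h :: "'b \<Rightarrow> real"
  assumes "finite A" "A \<noteq> {}" "sigma_finite_measure \<mu>" "\<And>a. a \<in> A \<Longrightarrow> g a \<in> measurable \<mu> N"
    "h \<in> borel_measurable N" "\<And>a. a \<in> A \<Longrightarrow> integrable \<mu> (\<lambda>x. h (g a x))"
  shows "(\<integral>y. h y \<partial>distr (uniform_count_measure A \<Otimes>\<^sub>M \<mu>) N (\<lambda>(a, x). g a x)) =
    (\<Sum>a\<in>A. \<integral>x. h (g a x) \<partial>\<mu>) / card A"
proof -
  note meas = measurable_uniform_pair[OF assms(1,4)]
  interpret U: prob_space "uniform_count_measure A"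
    by (rule prob_space_uniform_count_measure[OF assms(1,2)])
  interpret P: pair_sigma_finite "uniform_count_measure A" \<mu>
    by (intro pair_sigma_finite.intro U.sigma_finite_measure_axioms assms(3))
  have hm: "(\<lambda>p. h ((\<lambda>(a, x). g a x) p)) \<in> borel_measurable (uniform_count_measure A \<Otimes>\<^sub>M \<mu>)"
    by (rule measurable_compose[OF meas assms(5)])
  have int: "integrable (uniform_count_measure A \<Otimes>\<^sub>M \<mu>) (\<lambda>p. h ((\<lambda>(a, x). g a x) p))"
  proof (rule P.Fubini_integrable[OF hm])
    \<comment> \<open>With finitely many slices the outer integrability in Fubini's theorem is
      automatic.\<close>
    show "integrable (uniform_count_measure A) (\<lambda>a. \<integral>x. norm (h ((\<lambda>(a, x). g a x) (a, x))) \<partial>\<mu>)"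
      unfolding uniform_count_measure_def by (rule integrable_point_measure_finite[OF assms(1)])
    show "AE a in uniform_count_measure A. integrable \<mu> (\<lambda>x. h ((\<lambda>(a, x). g a x) (a, x)))"
      using assms(6) by (intro AE_I2) (simp add: space_uniform_count_measure)
  qed
  have "(\<integral>y. h y \<partial>distr (uniform_count_measure A \<Otimes>\<^sub>M \<mu>) N (\<lambda>(a, x). g a x)) =
      (\<integral>p. h ((\<lambda>(a, x). g a x) p) \<partial>(uniform_count_measure A \<Otimes>\<^sub>M \<mu>))"
    by (rule integral_distr[OF meas assms(5)])
  also have "\<dots> = (\<integral>a. \<integral>x. h (g a x) \<partial>\<mu> \<partial>uniform_count_measure A)"
    using P.integral_fst'[OF int] by simp
  also have "\<dots> = (\<Sum>a\<in>A. \<integral>x. h (g a x) \<partial>\<mu>) / card A"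
    by (rule integral_uniform_count_measure[OF assms(1)])
  finally show ?thesis .
qed

text \<open>Replaces the random parameter \<open>a\<close> by \<open>T a\<close>. Only the laws of
  \<open>g a\<close> and \<open>k (T a)\<close> have to agree, not the maps.\<close>

lemma distr_uniform_fibres:
  assumes A: "finite A" "A \<noteq> {}" and B: "finite B" and T: "T \<in> A \<rightarrow> B"
    and fib: "\<And>b. b \<in> B \<Longrightarrow> card {a \<in> A. T a = b} = c"
    and \<mu>: "sigma_finite_measure \<mu>"
    and g: "\<And>a. a \<in> A \<Longrightarrow> g a \<in> measurable \<mu> N" and k: "\<And>b. b \<in> B \<Longrightarrow> k b \<in> measurable \<mu> N"
    and eq: "\<And>a. a \<in> A \<Longrightarrow> distr \<mu> N (g a) = distr \<mu> N (k (T a))"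
  shows "distr (uniform_count_measure A \<Otimes>\<^sub>M \<mu>) N (\<lambda>(a, x). g a x) =
    distr (uniform_count_measure B \<Otimes>\<^sub>M \<mu>) N (\<lambda>(a, x). k a x)" (is "?L = ?R")
proof (rule measure_eqI)
  fix S assume "S \<in> sets ?L"
  then have S: "S \<in> sets N" by simp
  have "emeasure ?L S = ennreal (1 / card A) * (\<Sum>a\<in>A. emeasure (distr \<mu> N (k (T a))) S)"
    using emeasure_uniform_pair[OF A(1) \<mu> g S] eq by simp
  also have "\<dots> = ennreal (1 / card B) * (\<Sum>b\<in>B. emeasure (distr \<mu> N (k b)) S)"
    by (rule ennreal_average_equal_fibres[OF A B T fib])
  also have "\<dots> = emeasure ?R S"
    by (rule emeasure_uniform_pair[OF B \<mu> k S, symmetric])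
  finally show "emeasure ?L S = emeasure ?R S" .
qed simp

lemma ennreal_average_const:
  assumes "finite A" "A \<noteq> {}" "\<And>a. a \<in> A \<Longrightarrow> h a = v"
  shows "ennreal (1 / card A) * (\<Sum>a\<in>A. h a) = v"
proof -
  have "ennreal (1 / card A) * (\<Sum>a\<in>A. h a) = (ennreal (1 / card A) * ennreal (real (card A))) * v"
    using assms(3) by (simp add: mult.assoc ennreal_of_nat_eq_real_of_nat)
  also have "ennreal (1 / card A) * ennreal (real (card A)) = 1"
    using assms by (simp add: ennreal_mult[symmetric])
  finally show ?thesis by simp
qed

text \<open>For the first marginal of the coupling in \<open>W1_bound\<close>: the permutation there
  depends on the parameter, but the law of the slice does not.\<close>

lemma distr_uniform_const:
  assumes "finite A" "A \<noteq> {}" "sigma_finite_measure \<mu>" "\<And>a. a \<in> A \<Longrightarrow> g a \<in> measurable \<mu> N"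
    and "sets \<nu> = sets N" "\<And>a. a \<in> A \<Longrightarrow> distr \<mu> N (g a) = \<nu>"
  shows "distr (uniform_count_measure A \<Otimes>\<^sub>M \<mu>) N (\<lambda>(a, x). g a x) = \<nu>" (is "?L = _")
proof (rule measure_eqI)
  fix S assume "S \<in> sets ?L"
  then have S: "S \<in> sets N" by simp
  have "emeasure ?L S = ennreal (1 / card A) * (\<Sum>a\<in>A. emeasure \<nu> S)"
    using emeasure_uniform_pair[OF assms(1,3,4) S] assms(6) by simp
  also have "\<dots> = emeasure \<nu> S" by (rule ennreal_average_const[OF assms(1,2) refl])
  finally show "emeasure ?L S = emeasure \<nu> S" .
qed (simp add: assms)

section \<open>Compatibility of random images with permutations, projections and
  symmetrization\<close>

lemma inv_probD:
  assumes "\<mu> \<in> inv_prob F n S"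
  shows "prob_space \<mu>" "sigma_finite_measure \<mu>" "sets \<mu> = sets borel" "space \<mu> = UNIV" "emeasure \<mu> S = 1"
    and "\<sigma> permutes {1..n} \<Longrightarrow> distr \<mu> borel (push F n \<sigma>) = \<mu>"
proof -
  show "prob_space \<mu>" "sets \<mu> = sets borel" "emeasure \<mu> S = 1"
    using assms by (auto simp: inv_prob_def)
  then interpret prob_space \<mu> by simp
  show "sigma_finite_measure \<mu>" by (rule sigma_finite_measure_axioms)
  show "space \<mu> = UNIV" using sets_eq_imp_space_eq[OF \<open>sets \<mu> = sets borel\<close>] by simp
  assume s: "\<sigma> permutes {1..n}"
  have "act F n \<sigma> = push F n \<sigma>" using act_eq_push[OF s] by blast
  then show "distr \<mu> borel (push F n \<sigma>) = \<mu>" using assms s by (auto simp: inv_prob_def)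
qed

lemma push_measurable': "sets \<mu> = sets borel \<Longrightarrow> push F n f \<in> measurable \<mu> borel"
  using push_measurable measurable_cong_sets by blast

lemma distr_push_push:
  assumes "sets \<mu> = sets borel" "f \<in> {1..n} \<rightarrow> {1..m}"
  shows "distr (distr \<mu> borel (push F n f)) borel (push F m g) = distr \<mu> borel (push F n (g \<circ> f))"
proof -
  have "distr (distr \<mu> borel (push F n f)) borel (push F m g) = distr \<mu> borel (push F m g \<circ> push F n f)"
    by (rule distr_distr[OF push_measurable push_measurable'[OF assms(1)]])
  also have "push F m g \<circ> push F n f = push F n (g \<circ> f)"
    using push_push[OF assms(2)] by (simp add: fun_eq_iff)
  finally show ?thesis .
qed

lemma random_image_eq:
  "random_image F m n \<mu> = distr (uniform_count_measure (maps n m) \<Otimes>\<^sub>M \<mu>) borel (\<lambda>(f, x). push F n f x)"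
  unfolding random_image_def
  by (intro distr_cong refl)
    (auto simp: space_pair_measure space_uniform_count_measure rho_adj_eq_push PiE_iff)

lemma permutes_maps_into:
  fixes n N :: nat
  assumes "\<sigma> permutes {1..N}" "n \<le> N"
  shows "\<sigma> \<in> {1..n} \<rightarrow> {1..N}"
proof
  fix i assume "i \<in> {1..n}"
  then have "i \<in> {1..N}" using assms(2) by auto
  then show "\<sigma> i \<in> {1..N}" by (rule permutes_in_image[OF assms(1), THEN iffD2])
qed

text \<open>\<open>phi\<close> is \<open>push\<close> along the identity, so padding followed by a
  permutation of \<open>[N]\<close> is \<open>push\<close> along the restriction of that permutation
  to \<open>[n]\<close>.\<close>

lemma symmetrize_eq:
  assumes "n \<le> N"
  shows "symmetrize F N n \<mu> = distr (uniform_count_measure {\<sigma>. \<sigma> permutes {1..N}} \<Otimes>\<^sub>M \<mu>) borel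
     (\<lambda>(\<sigma>, x). push F n \<sigma> x)"
proof -
  have "act F N \<sigma> (phi F N n x) = push F n \<sigma> x" if "\<sigma> permutes {1..N}" for \<sigma> x
    using that assms push_push[of id n N F \<sigma> x] by (auto simp: act_eq_push phi_eq_push)
  then show ?thesis
    unfolding symmetrize_def
    by (intro distr_cong refl) (auto simp: space_pair_measure space_uniform_count_measure)
qed

text \<open>Used twice: with the block map it gives compatibility along \<open>psi_adj\<close>, and
  with a permutation, whose fibres have size one, it gives invariance.\<close>

lemma distr_random_image_push:
  assumes \<mu>: "sets \<mu> = sets borel" "sigma_finite_measure \<mu>" and "0 < M"
    and g: "g \<in> {1..M} \<rightarrow> {1..m}" "\<And>j. j \<in> {1..m} \<Longrightarrow> card {i \<in> {1..M}. g i = j} = q"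
  shows "distr (random_image F M n \<mu>) borel (push F M g) = random_image F m n \<mu>"
proof -
  have "distr (random_image F M n \<mu>) borel (push F M g) =
      distr (uniform_count_measure (maps n M) \<Otimes>\<^sub>M \<mu>) borel (push F M g \<circ> (\<lambda>(f, x). push F n f x))"
    unfolding random_image_eq
    by (intro distr_distr push_measurable measurable_uniform_pair finite_maps push_measurable' \<mu>)
  also have "\<dots> = distr (uniform_count_measure (maps n M) \<Otimes>\<^sub>M \<mu>) borel (\<lambda>(f, x). push F n (g \<circ> f) x)"
    by (intro distr_cong refl)
      (auto simp: space_pair_measure space_uniform_count_measure PiE_iff intro!: push_push)
  also have "\<dots> = random_image F m n \<mu>"
    unfolding random_image_eq
  proof (rule distr_uniform_fibres[where T = "\<lambda>f. restrict (g \<circ> f) {1..n}" and c = "q ^ n"])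
    show "(\<lambda>f. restrict (g \<circ> f) {1..n}) \<in> maps n M \<rightarrow> maps n m"
      using g(1) by (auto simp: PiE_iff Pi_iff)
    show "card {f \<in> maps n M. restrict (g \<circ> f) {1..n} = f'} = q ^ n" if "f' \<in> maps n m" for f'
      by (rule fibre_postcompose[OF g(2) that])
    show "distr \<mu> borel (push F n (g \<circ> f)) = distr \<mu> borel (push F n (restrict (g \<circ> f) {1..n}))" for f
    proof -
      have "push F n (g \<circ> f) = push F n (restrict (g \<circ> f) {1..n})"
        by (rule ext, rule push_cong) simp
      then show ?thesis by simp
    qed
  qed (use \<open>0 < M\<close> in \<open>simp_all only: finite_maps maps_nonempty push_measurable'[OF \<mu>(1)] \<mu>(2) not_False_eq_True\<close>)
  finally show ?thesis .
qed

lemma emeasure_random_image: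
  assumes "sets \<mu> = sets borel" "sigma_finite_measure \<mu>" "B \<in> sets borel"
  shows "emeasure (random_image F m n \<mu>) B =
    ennreal (1 / card (maps n m)) * (\<Sum>f\<in>maps n m. emeasure (distr \<mu> borel (push F n f)) B)"
  unfolding random_image_eq
  by (rule emeasure_uniform_pair[OF finite_maps assms(2) push_measurable'[OF assms(1)] assms(3)])

text \<open>For each fixed permutation, a uniform map on \<open>[N]\<close> restricts along it to a
  uniform map on \<open>[n]\<close>. Hence the average over maps is taken first, and what remains is
  constant in the permutation.\<close>

lemma random_image_symmetrize:
  assumes \<mu>: "sets \<mu> = sets borel" "sigma_finite_measure \<mu>"
    and \<nu>: "sigma_finite_measure (symmetrize F N n \<mu>)" and "n \<le> N" "0 < m"
  shows "random_image F m N (symmetrize F N n \<mu>) = random_image F m n \<mu>"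
proof (rule measure_eqI)
  let ?P = "{\<sigma>. \<sigma> permutes {1..N}}"
  fix B assume "B \<in> sets (random_image F m N (symmetrize F N n \<mu>))"
  then have B: "B \<in> sets borel" by (simp add: random_image_def)
  let ?E = "\<lambda>f. emeasure (distr \<mu> borel (push F n f)) B"
  have P: "finite ?P" "?P \<noteq> {}" by (auto simp: finite_permutations intro: permutes_id)
  have sets: "sets (symmetrize F N n \<mu>) = sets borel" by (simp add: symmetrize_def)
  have 1: "emeasure (distr (symmetrize F N n \<mu>) borel (push F N f)) B =
      ennreal (1 / card ?P) * (\<Sum>\<sigma>\<in>?P. ?E (f \<circ> \<sigma>))" for f
  proof -
    have "distr (symmetrize F N n \<mu>) borel (push F N f) =
        distr (uniform_count_measure ?P \<Otimes>\<^sub>M \<mu>) borel (push F N f \<circ> (\<lambda>(\<sigma>, x). push F n \<sigma> x))"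
      unfolding symmetrize_eq[OF \<open>n \<le> N\<close>]
      by (intro distr_distr push_measurable measurable_uniform_pair P push_measurable' \<mu>)
    also have "\<dots> = distr (uniform_count_measure ?P \<Otimes>\<^sub>M \<mu>) borel (\<lambda>(\<sigma>, x). push F n (f \<circ> \<sigma>) x)"
    proof (intro distr_cong refl)
      fix p assume "p \<in> space (uniform_count_measure ?P \<Otimes>\<^sub>M \<mu>)"
      then obtain \<sigma> x where p: "p = (\<sigma>, x)" "\<sigma> permutes {1..N}"
        by (auto simp: space_pair_measure space_uniform_count_measure)
      have "\<sigma> \<in> {1..n} \<rightarrow> {1..N}" by (rule permutes_maps_into[OF p(2) \<open>n \<le> N\<close>])
      then show "(push F N f \<circ> (\<lambda>(\<sigma>, x). push F n \<sigma> x)) p = (\<lambda>(\<sigma>, x). push F n (f \<circ> \<sigma>) x) p"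
        using p push_push by simp
    qed
    finally show ?thesis
      by (simp only:) (rule emeasure_uniform_pair[OF P(1) \<mu>(2) push_measurable'[OF \<mu>(1)] B])
  qed
  have 2: "ennreal (1 / card (maps N m)) * (\<Sum>f\<in>maps N m. ?E (f \<circ> \<sigma>)) = emeasure (random_image F m n \<mu>) B"
    if "\<sigma> \<in> ?P" for \<sigma>
  proof -
    have s: "\<sigma> permutes {1..N}" using that by simp
    have img: "\<sigma> ` {1..n} \<subseteq> {1..N}" using permutes_maps_into[OF s \<open>n \<le> N\<close>] by blast
    have inj: "inj_on \<sigma> {1..n}" by (rule permutes_inj_on[OF s])
    have "?E (f \<circ> \<sigma>) = ?E (restrict (f \<circ> \<sigma>) {1..n})" for f
    proof -
      have "push F n (f \<circ> \<sigma>) = push F n (restrict (f \<circ> \<sigma>) {1..n})"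
        by (rule ext, rule push_cong) simp
      then show ?thesis by simp
    qed
    then have "ennreal (1 / card (maps N m)) * (\<Sum>f\<in>maps N m. ?E (f \<circ> \<sigma>)) =
        ennreal (1 / card (maps N m)) * (\<Sum>f\<in>maps N m. ?E (restrict (f \<circ> \<sigma>) {1..n}))"
      by simp
    also have "\<dots> = ennreal (1 / card (maps n m)) * (\<Sum>f\<in>maps n m. ?E f)"
    proof (rule ennreal_average_equal_fibres[OF finite_maps maps_nonempty[OF \<open>0 < m\<close>] finite_maps])
      show "(\<lambda>f. restrict (f \<circ> \<sigma>) {1..n}) \<in> maps N m \<rightarrow> maps n m"
      proof
        fix f assume f: "f \<in> maps N m"
        have "f (\<sigma> i) \<in> {1..m}" if "i \<in> {1..n}" for i
          using img that by (intro PiE_mem[OF f]) blast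
        then show "restrict (f \<circ> \<sigma>) {1..n} \<in> maps n m" by auto
      qed
    qed (rule fibre_precompose[OF inj img])
    also have "\<dots> = emeasure (random_image F m n \<mu>) B"
      by (rule emeasure_random_image[OF \<mu> B, symmetric])
    finally show ?thesis .
  qed
  have "emeasure (random_image F m N (symmetrize F N n \<mu>)) B =
      ennreal (1 / card (maps N m)) * (\<Sum>f\<in>maps N m. ennreal (1 / card ?P) * (\<Sum>\<sigma>\<in>?P. ?E (f \<circ> \<sigma>)))"
    unfolding emeasure_random_image[OF sets \<nu> B] 1 ..
  also have "\<dots> = ennreal (1 / card ?P) * (ennreal (1 / card (maps N m)) * (\<Sum>f\<in>maps N m. \<Sum>\<sigma>\<in>?P. ?E (f \<circ> \<sigma>)))"
    unfolding sum_distrib_left[symmetric] by (rule mult.left_commute)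
  also have "\<dots> = ennreal (1 / card ?P) * (\<Sum>\<sigma>\<in>?P. ennreal (1 / card (maps N m)) * (\<Sum>f\<in>maps N m. ?E (f \<circ> \<sigma>)))"
    unfolding sum_distrib_left[symmetric] by (subst sum.swap) (rule refl)
  also have "\<dots> = emeasure (random_image F m n \<mu>) B"
    by (rule ennreal_average_const[OF P 2])
  finally show "emeasure (random_image F m N (symmetrize F N n \<mu>)) B = emeasure (random_image F m n \<mu>) B" .
qed (simp add: random_image_def)

lemma permutation_fibre:
  assumes "\<sigma> permutes {1..n}" "j \<in> {1..n}"
  shows "card {i \<in> {1..n}. \<sigma> i = j} = 1"
proof -
  have "{i \<in> {1..n}. \<sigma> i = j} = {inv \<sigma> j}"
    using assms permutes_inverses[OF assms(1)] permutes_in_image[OF permutes_inv[OF assms(1)], of j]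
    by auto
  then show ?thesis by simp
qed

text \<open>Invariance comes from the random map: following it by a permutation of
  \<open>[m]\<close> leaves it uniform. Full mass on \<open>S'\<close> holds slice by slice.\<close>

lemma random_image_inv_prob:
  assumes \<mu>: "\<mu> \<in> inv_prob F n S" and "0 < m" and S: "S' \<in> sets borel"
    and pres: "\<And>f. f \<in> maps n m \<Longrightarrow> push F n f ` S \<subseteq> S'"
  shows "random_image F m n \<mu> \<in> inv_prob F m S'"
proof -
  note D = inv_probD[OF \<mu>]
  interpret prob_space \<mu> by (rule D)
  note maps = finite_maps maps_nonempty[OF \<open>0 < m\<close>]
  have UNIV_borel: "UNIV \<in> sets (borel :: coords measure)" by simp
  have pushd: "prob_space (distr \<mu> borel (push F n f))" for f
    by (rule prob_space_distr[OF push_measurable'[OF D(3)]])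
  have full: "emeasure (distr \<mu> borel (push F n f)) UNIV = 1" for f
    using prob_space.emeasure_space_1[OF pushd[of f]] by simp
  have S1: "emeasure (distr \<mu> borel (push F n f)) S' = 1" if "f \<in> maps n m" for f
  proof -
    have "emeasure (distr \<mu> borel (push F n f)) S' = emeasure \<mu> (push F n f -` S' \<inter> space \<mu>)"
      using push_measurable'[OF D(3)] S by (rule emeasure_distr)
    moreover have "emeasure \<mu> S \<le> emeasure \<mu> (push F n f -` S' \<inter> space \<mu>)"
      using pres[OF that] measurable_sets[OF push_measurable'[OF D(3)] S]
      by (intro emeasure_mono) (auto simp: D(4))
    ultimately show ?thesis using D(5) prob_space.emeasure_le_1[OF pushd] by (metis antisym)
  qed
  have "prob_space (random_image F m n \<mu>)"
  proof (rule prob_spaceI)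
    have "emeasure (random_image F m n \<mu>) UNIV = 1"
      unfolding emeasure_random_image[OF D(3,2) UNIV_borel]
      using full by (intro ennreal_average_const maps)
    then show "emeasure (random_image F m n \<mu>) (space (random_image F m n \<mu>)) = 1"
      by (simp add: random_image_def)
  qed
  moreover have "emeasure (random_image F m n \<mu>) S' = 1"
    unfolding emeasure_random_image[OF D(3,2) S] using S1 by (intro ennreal_average_const maps)
  moreover have "distr (random_image F m n \<mu>) borel (act F m \<sigma>) = random_image F m n \<mu>"
    if s: "\<sigma> permutes {1..m}" for \<sigma>
  proof -
    have "act F m \<sigma> = push F m \<sigma>" using act_eq_push[OF s] by blast
    moreover have "\<sigma> \<in> {1..m} \<rightarrow> {1..m}" by (rule permutes_maps_into[OF s order_refl])
    ultimately show ?thesis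
      using distr_random_image_push[OF D(3,2) \<open>0 < m\<close> _ permutation_fibre[OF s]] by simp
  qed
  ultimately show ?thesis by (simp add: inv_prob_def random_image_def)
qed

text \<open>Any \<open>f\<close> from \<open>[n]\<close> to \<open>[m]\<close> factors as an injection into \<open>[m n]\<close> followed by the block map.\<close>

lemma push_image_subset:
  assumes "\<And>n \<sigma>. 0 < n \<Longrightarrow> \<sigma> permutes {1..n} \<Longrightarrow> act F n \<sigma> ` \<Omega> n \<subseteq> \<Omega> n"
    and "\<And>n N. 0 < n \<Longrightarrow> 0 < N \<Longrightarrow> n dvd N \<Longrightarrow> psi_adj F N n ` \<Omega> N \<subseteq> \<Omega> n"
    and "\<And>n N. 0 < n \<Longrightarrow> n \<le> N \<Longrightarrow> phi F N n ` \<Omega> n \<subseteq> \<Omega> N"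
    and "0 < n" "0 < m" "f \<in> maps n m"
  shows "push F n f ` \<Omega> n \<subseteq> \<Omega> m"
proof -
  \<comment> \<open>Only permutations, zero-padding and \<open>psi_adj\<close> are known to preserve
    the sets, so \<open>f\<close> is assembled from these. With \<open>N = m * n\<close> the blocks
    have length \<open>n\<close>, and \<open>h\<close> puts \<open>i\<close> at offset
    \<open>i\<close> of block number \<open>f i\<close>: the offset recovers \<open>i\<close>, so
    \<open>h\<close> is injective, and the block number recovers \<open>f i\<close>.\<close>
  define N where "N = m * n"
  define h where "h i = (f i - 1) * n + i" for i
  have N: "n \<le> N" "0 < N" "m dvd N" using assms(4,5) by (auto simp: N_def)
  have f: "1 \<le> f i" "f i \<le> m" if "i \<in> {1..n}" for i
    using PiE_mem[OF assms(6) that] by auto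
  have h1: "h i - 1 = (f i - 1) * n + (i - 1)" if "i \<in> {1..n}" for i
    using that by (auto simp: h_def)
  have "h ` {1..n} \<subseteq> {1..N}"
  proof
    fix j assume "j \<in> h ` {1..n}"
    then obtain i where i: "i \<in> {1..n}" "j = h i" by blast
    have "h i \<le> (f i - 1) * n + n" using i by (simp add: h_def)
    also have "\<dots> = Suc (f i - 1) * n" by simp
    also have "\<dots> \<le> m * n" using f[OF i(1)] by (intro mult_le_mono1) simp
    finally show "j \<in> {1..N}" using i by (simp add: N_def h_def)
  qed
  moreover have "inj_on h {1..n}"
  proof (rule inj_onI)
    fix i j assume ij: "i \<in> {1..n}" "j \<in> {1..n}" "h i = h j"
    then have "(h i - 1) mod n = (h j - 1) mod n" by simp
    then have "i - 1 = j - 1" unfolding h1[OF ij(1)] h1[OF ij(2)] using ij by auto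
    then show "i = j" using ij by auto
  qed
  ultimately obtain \<sigma> where \<sigma>: "\<sigma> permutes {1..N}" "\<And>i. i \<in> {1..n} \<Longrightarrow> \<sigma> i = h i"
    using extend_to_permutation[of "{1..N}" "{1..n}" h] N(1) by auto
  have maps: "id \<in> {1..n} \<rightarrow> {1..N}" "\<sigma> \<in> {1..N} \<rightarrow> {1..N}" "\<sigma> \<circ> id \<in> {1..n} \<rightarrow> {1..N}"
    using N permutes_maps_into[OF \<sigma>(1)] by auto
  show ?thesis
  proof
    fix y assume "y \<in> push F n f ` \<Omega> n"
    then obtain x where x: "x \<in> \<Omega> n" "y = push F n f x" by blast
    have "(block N m \<circ> (\<sigma> \<circ> id)) i = f i" if "i \<in> {1..n}" for i
    proof -
      have "(h i - 1) div n = f i - 1" unfolding h1[OF that] using that by (auto simp del: add_diff_assoc)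
      then show ?thesis using that f[OF that] assms(4,5) \<sigma>(2)[OF that] by (simp add: block_def N_def)
    qed
    then have "y = push F n (block N m \<circ> (\<sigma> \<circ> id)) x"
      unfolding x(2) by (intro push_cong) simp
    also have "\<dots> = psi_adj F N m (act F N \<sigma> (phi F N n x))"
      by (simp add: psi_adj_eq_push[OF assms(5) N(2,3)] act_eq_push[OF \<sigma>(1)] phi_eq_push[OF N(1)]
        push_push[OF maps(1)] push_push[OF maps(3)] del: comp_id)
    finally have "y = psi_adj F N m (act F N \<sigma> (phi F N n x))" .
    moreover have "phi F N n x \<in> \<Omega> N" using assms(3)[OF assms(4) N(1)] x(1) by blast
    then have "act F N \<sigma> (phi F N n x) \<in> \<Omega> N" using assms(1)[OF N(2) \<sigma>(1)] by blast
    ultimately show "y \<in> \<Omega> m" using assms(2)[OF assms(5) N(2,3)] by blast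
  qed
qed


section \<open>The Wasserstein bound\<close>

lemma sum_basis_permute:
  assumes "\<sigma> permutes {1..n}"
  shows "(\<Sum>a\<in>basis F n. h (imap \<sigma> a)) = (\<Sum>a\<in>basis F n. h a)"
proof (rule sum.reindex_bij_betw)
  have inv: "inv \<sigma> permutes {1..n}" by (rule permutes_inv[OF assms])
  show "bij_betw (imap \<sigma>) (basis F n) (basis F n)"
  proof (rule bij_betwI[where g = "imap (inv \<sigma>)"])
    show "imap \<sigma> \<in> basis F n \<rightarrow> basis F n" "imap (inv \<sigma>) \<in> basis F n \<rightarrow> basis F n"
      using imap_basis permutes_maps_into[OF assms order_refl] permutes_maps_into[OF inv order_refl] by blast+
    show "imap (inv \<sigma>) (imap \<sigma> a) = a" for a
      unfolding imap_comp by (rule imap_id) (simp add: permutes_inverses[OF assms])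
    show "imap \<sigma> (imap (inv \<sigma>) a) = a" for a
      unfolding imap_comp by (rule imap_id) (simp add: permutes_inverses[OF assms])
  qed
qed

lemma push_permute:
  assumes "\<sigma> permutes {1..n}" "a \<in> basis F n"
  shows "push F n \<sigma> x (imap \<sigma> a) = x a"
proof -
  have "{b. b \<in> basis F n \<and> imap \<sigma> b = imap \<sigma> a} = {a}"
  proof -
    have "b = a" if "imap \<sigma> b = imap \<sigma> a" for b
    proof -
      have "imap (inv \<sigma>) (imap \<sigma> c) = c" for c
        unfolding imap_comp by (rule imap_id) (simp add: permutes_inverses[OF assms(1)])
      then show ?thesis using that by metis
    qed
    then show ?thesis using assms(2) by auto
  qed
  then show ?thesis by (simp add: push_def)
qed

lemma isupp_imap: "isupp (imap f a) = f ` isupp a"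
  by (induction a) auto

lemma push_diff_eq:
  "push F n g x b - push F n f x b =
    (\<Sum>a\<in>basis F n. x a * ((if imap g a = b then 1 else 0) - (if imap f a = b then 1 else 0)))"
  by (simp add: push_def right_diff_distrib sum_subtractf sum.If_cases finite_basis Int_def
      if_distrib[of "(*) _"] cong: if_cong)

text \<open>A coordinate \<open>x a\<close> contributes only if the two images of \<open>a\<close>
  differ, and then at most \<open>2 * \<bar>x a\<bar>\<close>. In that case some index in the
  support of \<open>a\<close> is a disagreement, so charging this cost to every disagreement in the
  support only increases the total. Exchanging sums collects the charges by index.\<close>

lemma norm1_push_diff:
  "norm1 F m (\<lambda>b. push F n g x b - push F n f x b) \<le>
    (\<Sum>i\<in>{i \<in> {1..n}. g i \<noteq> f i}. 2 * (\<Sum>a\<in>{a \<in> basis F n. i \<in> isupp a}. \<bar>x a\<bar>))"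
proof -
  let ?D = "{i \<in> {1..n}. g i \<noteq> f i}"
  have ind: "(\<Sum>b\<in>basis F m. \<bar>(if imap g a = b then 1 else 0) - (if imap f a = b then 1 else (0::real))\<bar>)
      \<le> 2 * real (card (?D \<inter> isupp a))" if a: "a \<in> basis F n" for a
  proof (cases "imap g a = imap f a")
    case False
    then have "?D \<inter> isupp a \<noteq> {}"
      using imap_cong[of a g f] isupp_basis[OF a] by blast
    then have "1 \<le> card (?D \<inter> isupp a)"
      using isupp_basis[OF a] by (simp add: Suc_le_eq card_gt_0_iff)
    have "(\<Sum>b\<in>basis F m. \<bar>(if imap g a = b then 1 else 0) - (if imap f a = b then 1 else (0::real))\<bar>) \<le>
        (\<Sum>b\<in>basis F m. (if imap g a = b then 1 else 0) + (if imap f a = b then 1 else 0))"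
      by (intro sum_mono) auto
    also have "\<dots> \<le> 2" by (simp add: sum.distrib finite_basis)
    finally show ?thesis using \<open>1 \<le> card (?D \<inter> isupp a)\<close> by linarith
  qed simp
  have "norm1 F m (\<lambda>b. push F n g x b - push F n f x b) \<le>
      (\<Sum>b\<in>basis F m. \<Sum>a\<in>basis F n. \<bar>x a\<bar> * \<bar>(if imap g a = b then 1 else 0) - (if imap f a = b then 1 else 0)\<bar>)"
    unfolding norm1_def push_diff_eq by (intro sum_mono order_trans[OF sum_abs]) (simp add: abs_mult)
  also have "\<dots> = (\<Sum>a\<in>basis F n. \<bar>x a\<bar> *
      (\<Sum>b\<in>basis F m. \<bar>(if imap g a = b then 1 else 0) - (if imap f a = b then 1 else 0)\<bar>))"
    unfolding sum_distrib_left by (rule sum.swap)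
  also have "\<dots> \<le> (\<Sum>a\<in>basis F n. \<bar>x a\<bar> * (2 * real (card (?D \<inter> isupp a))))"
    by (intro sum_mono mult_left_mono ind) auto
  also have "\<dots> = (\<Sum>a\<in>basis F n. \<Sum>i\<in>?D. if i \<in> isupp a then 2 * \<bar>x a\<bar> else 0)"
    by (intro sum.cong refl) (simp add: sum.If_cases)
  also have "\<dots> = (\<Sum>i\<in>?D. \<Sum>a\<in>basis F n. if i \<in> isupp a then 2 * \<bar>x a\<bar> else 0)"
    by (rule sum.swap)
  also have "\<dots> = (\<Sum>i\<in>?D. 2 * (\<Sum>a\<in>{a \<in> basis F n. i \<in> isupp a}. \<bar>x a\<bar>))"
    by (simp add: sum.If_cases finite_basis Int_def sum_distrib_left)
  finally show ?thesis .
qed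

text \<open>Transpositions make the mass at an index the same for all \<open>n\<close> indices.
  Summed over the indices, each label is counted once per point of its support, hence at most
  \<open>deg F\<close> times.\<close>

lemma invariant_mass_at_index:
  fixes w :: "idx \<Rightarrow> real"
  assumes inv: "\<And>\<sigma> a. \<sigma> permutes {1..n} \<Longrightarrow> a \<in> basis F n \<Longrightarrow> w (imap \<sigma> a) = w a"
    and pos: "\<And>a. 0 \<le> w a" and i: "i \<in> {1..n}"
  shows "(\<Sum>a\<in>{a \<in> basis F n. i \<in> isupp a}. w a) \<le> deg F * (\<Sum>a\<in>basis F n. w a) / n"
proof -
  define u where "u i = (\<Sum>a\<in>basis F n. if i \<in> isupp a then w a else 0)" for i
  have u: "u k = u i" if k: "k \<in> {1..n}" for k
  proof -
    let ?s = "Transposition.transpose i k"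
    have s: "?s permutes {1..n}" using i k by (simp add: permutes_swap_id)
    have "u i = (\<Sum>a\<in>basis F n. if k \<in> isupp (imap ?s a) then w (imap ?s a) else 0)"
      unfolding u_def
    proof (intro sum.cong refl)
      fix a assume a: "a \<in> basis F n"
      have "k \<in> isupp (imap ?s a) \<longleftrightarrow> i \<in> isupp a"
        unfolding isupp_imap by (metis image_iff transpose_apply_first transpose_involutory)
      then show "(if i \<in> isupp a then w a else 0) = (if k \<in> isupp (imap ?s a) then w (imap ?s a) else 0)"
        using inv[OF s a] by simp
    qed
    also have "\<dots> = u k" unfolding u_def by (rule sum_basis_permute[OF s])
    finally show ?thesis ..
  qed
  have "n * u i = (\<Sum>k = 1..n. u k)" using u by simp
  also have "\<dots> = (\<Sum>a\<in>basis F n. \<Sum>k = 1..n. if k \<in> isupp a then w a else 0)"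
    unfolding u_def by (rule sum.swap)
  also have "\<dots> = (\<Sum>a\<in>basis F n. real (card (isupp a)) * w a)"
  proof (intro sum.cong refl)
    fix a assume "a \<in> basis F n"
    then have "{1..n} \<inter> isupp a = isupp a" using isupp_basis by blast
    then show "(\<Sum>k = 1..n. if k \<in> isupp a then w a else 0) = real (card (isupp a)) * w a"
      by (simp add: sum.If_cases)
  qed
  also have "\<dots> \<le> (\<Sum>a\<in>basis F n. deg F * w a)"
    using isupp_basis pos by (intro sum_mono mult_right_mono) auto
  finally have "n * u i \<le> deg F * (\<Sum>a\<in>basis F n. w a)" by (simp add: sum_distrib_left)
  moreover have "0 < n" using i by auto
  ultimately have "u i \<le> deg F * (\<Sum>a\<in>basis F n. w a) / n" by (simp add: field_simps)
  then show ?thesis by (simp add: u_def sum.If_cases finite_basis Int_def)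
qed

lemma integrable_coordinate:
  assumes "sets \<mu> = sets borel" "integrable \<mu> (norm1 F n)" "a \<in> basis F n"
  shows "integrable \<mu> (\<lambda>x. x a)"
proof (rule Bochner_Integration.integrable_bound[OF assms(2)])
  show "(\<lambda>x. x a) \<in> borel_measurable \<mu>"
    using coordinate_measurable measurable_cong_sets[OF assms(1) refl] by blast
  have "\<bar>x a\<bar> \<le> norm1 F n x" for x
    unfolding norm1_def using assms(3) by (intro member_le_sum) (auto simp: finite_basis)
  then show "AE x in \<mu>. norm (x a) \<le> norm (norm1 F n x)"
    by (intro AE_I2) (metis abs_ge_self order_trans real_norm_def)
qed

text \<open>Used with \<open>h\<close> the absolute value for the \<open>W1\<close> bound and with
  the identity for the means.\<close>

lemma invariant_integral:
  fixes h :: "real \<Rightarrow> real"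
  assumes "\<mu> \<in> inv_prob F n S" "\<sigma> permutes {1..n}" "a \<in> basis F n" "h \<in> borel_measurable borel"
  shows "(\<integral>x. h (x (imap \<sigma> a)) \<partial>\<mu>) = (\<integral>x. h (x a) \<partial>\<mu>)"
proof -
  note D = inv_probD[OF assms(1)]
  have "(\<integral>x. h (x (imap \<sigma> a)) \<partial>\<mu>) = (\<integral>x. h (x (imap \<sigma> a)) \<partial>distr \<mu> borel (push F n \<sigma>))"
    by (simp only: D(6)[OF assms(2)])
  also have "\<dots> = (\<integral>x. h (push F n \<sigma> x (imap \<sigma> a)) \<partial>\<mu>)"
    by (rule integral_distr[OF push_measurable'[OF D(3)] measurable_compose[OF coordinate_measurable assms(4)]])
  finally show ?thesis by (simp add: push_permute[OF assms(2,3)])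
qed

lemma norm1_diff_measurable:
  "(\<lambda>(x, y). ennreal (norm1 F m (\<lambda>a. x a - y a))) \<in> borel_measurable (borel \<Otimes>\<^sub>M borel)"
proof -
  note [measurable] = measurable_compose[OF measurable_fst coordinate_measurable]
    measurable_compose[OF measurable_snd coordinate_measurable]
  show ?thesis unfolding norm1_def case_prod_beta by measurable
qed

text \<open>
  The coupling sends \<open>(f, X)\<close> to the images of \<open>X\<close> under a permuted block map close to \<open>f\<close> and under
  \<open>f\<close> itself.  By exchangeability, the mass of the coordinates in which a given index occurs is the
  same for all indices (\<open>invariant_mass_at_index\<close>), so only the number of disagreements matters.
\<close>

lemma W1_bound:
  assumes m: "0 < m" "0 < n" "m dvd n" and \<mu>: "\<mu> \<in> inv_prob F n S"
    and int: "integrable \<mu> (norm1 F n)"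
  shows "W1 F m (distr \<mu> borel (psi_adj F n m)) (random_image F m n \<mu>)
    \<le> ennreal (2 * real (deg F) * sqrt ((real m - 1) / n) * (\<integral>x. norm1 F n x \<partial>\<mu>))"
proof -
  note D = inv_probD[OF \<mu>]
  let ?b = "block n m"
  let ?dev = "\<lambda>f. \<Sum>j = 1..m. \<bar>real (card {i \<in> {1..n}. f i = j}) - n / m\<bar>"
  let ?I = "\<integral>x. norm1 F n x \<partial>\<mu>"
  note maps = finite_maps maps_nonempty[OF m(1)]
  have ex: "\<exists>p. p permutes {1..n} \<and> real (card {i \<in> {1..n}. ?b (p i) \<noteq> f i}) \<le> ?dev f" if f: "f \<in> maps n m" for f
  proof -
    have f': "f \<in> {1..n} \<rightarrow> {1..m}" using f by (simp add: PiE_iff Pi_iff)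
    obtain p where "p permutes {1..n}" "real (card {i \<in> {1..n}. ?b (p i) \<noteq> f i}) \<le> ?dev f"
      by (rule near_equidistributed_permutation[OF f' m(1,3) block_fibre[OF m]])
    then show ?thesis by blast
  qed
  have "\<exists>p. \<forall>f\<in>maps n m. p f permutes {1..n} \<and> real (card {i \<in> {1..n}. ?b (p f i) \<noteq> f i}) \<le> ?dev f"
    by (intro bchoice ballI ex)
  then obtain p where p: "\<And>f. f \<in> maps n m \<Longrightarrow> p f permutes {1..n}"
    "\<And>f. f \<in> maps n m \<Longrightarrow> real (card {i \<in> {1..n}. ?b (p f i) \<noteq> f i}) \<le> ?dev f"
    by blast
  let ?G = "\<lambda>f x. (push F n (?b \<circ> p f) x, push F n f x)"
  define \<pi> where "\<pi> = distr (uniform_count_measure (maps n m) \<Otimes>\<^sub>M \<mu>) (borel \<Otimes>\<^sub>M borel) (\<lambda>(f, x). ?G f x)"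
  have Gm: "?G f \<in> measurable \<mu> (borel \<Otimes>\<^sub>M borel)" for f
    by (intro measurable_Pair push_measurable'[OF D(3)])
  note pairm = measurable_uniform_pair[where g = ?G, OF finite_maps Gm]
  have "distr \<pi> borel fst = distr \<mu> borel (psi_adj F n m)"
  proof -
    have psi: "psi_adj F n m = push F n ?b" using psi_adj_eq_push[OF m] by blast
    have "distr \<pi> borel fst = distr (uniform_count_measure (maps n m) \<Otimes>\<^sub>M \<mu>) borel (fst \<circ> (\<lambda>(f, x). ?G f x))"
      unfolding \<pi>_def by (rule distr_distr[OF measurable_fst pairm])
    also have "fst \<circ> (\<lambda>(f, x). ?G f x) = (\<lambda>(f, x). push F n (?b \<circ> p f) x)" by auto
    also have "distr (uniform_count_measure (maps n m) \<Otimes>\<^sub>M \<mu>) borel (\<lambda>(f, x). push F n (?b \<circ> p f) x) =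
        distr \<mu> borel (psi_adj F n m)"
      unfolding psi
    proof (rule distr_uniform_const[OF maps D(2) push_measurable'[OF D(3)] sets_distr])
      fix f assume f: "f \<in> maps n m"
      \<comment> \<open>Invariance of the law absorbs \<open>p f\<close> before the block map acts,
        so its dependence on \<open>f\<close> does no harm to the marginal.\<close>
      show "distr \<mu> borel (push F n (?b \<circ> p f)) = distr \<mu> borel (push F n ?b)"
        using distr_push_push[OF D(3) permutes_maps_into[OF p(1)[OF f] order_refl], of F ?b]
        by (simp only: D(6)[OF p(1)[OF f]])
    qed
    finally show ?thesis .
  qed
  moreover have "distr \<pi> borel snd = random_image F m n \<mu>"
  proof -
    have "distr \<pi> borel snd = distr (uniform_count_measure (maps n m) \<Otimes>\<^sub>M \<mu>) borel (snd \<circ> (\<lambda>(f, x). ?G f x))"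
      unfolding \<pi>_def by (rule distr_distr[OF measurable_snd pairm])
    also have "snd \<circ> (\<lambda>(f, x). ?G f x) = (\<lambda>(f, x). push F n f x)" by auto
    finally show ?thesis by (simp only: random_image_eq)
  qed
  ultimately have "\<pi> \<in> couplings (distr \<mu> borel (psi_adj F n m)) (random_image F m n \<mu>)"
    by (simp add: couplings_def \<pi>_def)
  then have "W1 F m (distr \<mu> borel (psi_adj F n m)) (random_image F m n \<mu>) \<le>
      (\<integral>\<^sup>+(x, y). ennreal (norm1 F m (\<lambda>a. x a - y a)) \<partial>\<pi>)"
    unfolding W1_def by (rule INF_lower)
  also have "\<dots> = ennreal (1 / card (maps n m)) * (\<Sum>f\<in>maps n m.
      \<integral>\<^sup>+x. ennreal (norm1 F m (\<lambda>a. push F n (?b \<circ> p f) x a - push F n f x a)) \<partial>\<mu>)"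
    unfolding \<pi>_def
    using nn_integral_uniform_pair[where g = ?G, OF finite_maps D(2) Gm norm1_diff_measurable] by simp
  \<comment> \<open>\<open>?dev f\<close> bounds the number of disagreements, and the other factor
    bounds the expected cost of a single one.\<close>
  also have "\<dots> \<le> ennreal (1 / card (maps n m)) * (\<Sum>f\<in>maps n m. ennreal (?dev f * (2 * (deg F * ?I / n))))"
  proof (intro mult_left_mono sum_mono)
    fix f assume f: "f \<in> maps n m"
    let ?D = "{i \<in> {1..n}. (?b \<circ> p f) i \<noteq> f i}"
    let ?A = "\<lambda>i. {a \<in> basis F n. i \<in> isupp a}"
    have coord: "integrable \<mu> (\<lambda>x. \<bar>x a\<bar>)" if "a \<in> basis F n" for a
      using integrable_coordinate[OF D(3) int that] by (rule integrable_abs)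
    have intA: "integrable \<mu> (\<lambda>x. \<Sum>i\<in>?D. 2 * (\<Sum>a\<in>?A i. \<bar>x a\<bar>))"
      using coord by (intro Bochner_Integration.integrable_sum integrable_mult_right) auto
    have mass: "(\<Sum>a\<in>?A i. \<integral>x. \<bar>x a\<bar> \<partial>\<mu>) \<le> deg F * ?I / n" if "i \<in> {1..n}" for i
    proof -
      have "(\<Sum>a\<in>?A i. \<integral>x. \<bar>x a\<bar> \<partial>\<mu>) \<le> deg F * (\<Sum>a\<in>basis F n. \<integral>x. \<bar>x a\<bar> \<partial>\<mu>) / n"
        using that by (intro invariant_mass_at_index invariant_integral[OF \<mu>]) auto
      also have "(\<Sum>a\<in>basis F n. \<integral>x. \<bar>x a\<bar> \<partial>\<mu>) = ?I"
        unfolding norm1_def using coord by (intro Bochner_Integration.integral_sum[symmetric])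
      finally show ?thesis .
    qed
    have I: "0 \<le> ?I" by (intro integral_nonneg_AE AE_I2) (simp add: norm1_def sum_nonneg)
    have "(\<integral>\<^sup>+x. ennreal (norm1 F m (\<lambda>a. push F n (?b \<circ> p f) x a - push F n f x a)) \<partial>\<mu>) \<le>
        (\<integral>\<^sup>+x. ennreal (\<Sum>i\<in>?D. 2 * (\<Sum>a\<in>?A i. \<bar>x a\<bar>)) \<partial>\<mu>)"
      by (intro nn_integral_mono ennreal_leI norm1_push_diff)
    also have "\<dots> = ennreal (\<integral>x. (\<Sum>i\<in>?D. 2 * (\<Sum>a\<in>?A i. \<bar>x a\<bar>)) \<partial>\<mu>)"
      by (intro nn_integral_eq_integral intA AE_I2 sum_nonneg mult_nonneg_nonneg) auto
    also have "(\<integral>x. (\<Sum>i\<in>?D. 2 * (\<Sum>a\<in>?A i. \<bar>x a\<bar>)) \<partial>\<mu>) = (\<Sum>i\<in>?D. 2 * (\<Sum>a\<in>?A i. \<integral>x. \<bar>x a\<bar> \<partial>\<mu>))"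
      using coord by (subst Bochner_Integration.integral_sum) (auto simp: Bochner_Integration.integral_sum)
    also have "ennreal \<dots> \<le> ennreal (?dev f * (2 * (deg F * ?I / n)))"
    proof (rule ennreal_leI)
      have "(\<Sum>i\<in>?D. 2 * (\<Sum>a\<in>?A i. \<integral>x. \<bar>x a\<bar> \<partial>\<mu>)) \<le> (\<Sum>i\<in>?D. 2 * (deg F * ?I / n))"
        by (intro sum_mono mult_left_mono mass) auto
      also have "\<dots> \<le> ?dev f * (2 * (deg F * ?I / n))"
        using p(2)[OF f] I by (simp add: mult_right_mono del: times_divide_eq_right)
      finally show "(\<Sum>i\<in>?D. 2 * (\<Sum>a\<in>?A i. \<integral>x. \<bar>x a\<bar> \<partial>\<mu>)) \<le> ?dev f * (2 * (deg F * ?I / n))" .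
    qed
    finally show "(\<integral>\<^sup>+x. ennreal (norm1 F m (\<lambda>a. push F n (?b \<circ> p f) x a - push F n f x a)) \<partial>\<mu>) \<le>
        ennreal (?dev f * (2 * (deg F * ?I / n)))" .
  qed simp
  also have "\<dots> = ennreal ((\<Sum>f\<in>maps n m. ?dev f) / card (maps n m) * (2 * (deg F * ?I / n)))"
  proof -
    have I: "0 \<le> ?I" by (intro integral_nonneg_AE AE_I2) (simp add: norm1_def sum_nonneg)
    have scale: "1 / c * (\<Sum>f\<in>A. d f * K) = (\<Sum>f\<in>A. d f) / c * K"
      for c K :: real and d and A :: "(nat \<Rightarrow> nat) set"
      by (simp flip: sum_distrib_right)
    have h1: "(\<Sum>f\<in>maps n m. ennreal (?dev f * (2 * (deg F * ?I / n)))) =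
        ennreal (\<Sum>f\<in>maps n m. ?dev f * (2 * (deg F * ?I / n)))"
      using I by (intro sum_ennreal mult_nonneg_nonneg sum_nonneg) auto
    have h2: "ennreal (1 / card (maps n m)) * ennreal (\<Sum>f\<in>maps n m. ?dev f * (2 * (deg F * ?I / n))) =
        ennreal (1 / card (maps n m) * (\<Sum>f\<in>maps n m. ?dev f * (2 * (deg F * ?I / n))))"
      by (rule ennreal_mult'[symmetric]) simp
    show ?thesis unfolding h1 h2 scale ..
  qed
  also have "\<dots> \<le> ennreal (sqrt (n * (real m - 1)) * (2 * (deg F * ?I / n)))"
  proof (intro ennreal_leI mult_right_mono average_fibre_deviation m)
    have "0 \<le> ?I" by (intro integral_nonneg_AE AE_I2) (simp add: norm1_def sum_nonneg)
    then show "0 \<le> 2 * (deg F * ?I / n)" by simp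
  qed
  also have "sqrt (n * (real m - 1)) * (2 * (deg F * ?I / n)) = 2 * real (deg F) * sqrt ((real m - 1) / n) * ?I"
  proof -
    \<comment> \<open>Pulling \<open>n\<close> out of the root cancels the \<open>1 / n\<close> from
      the mass at an index.\<close>
    have "sqrt (n * (real m - 1)) = sqrt ((real n)\<^sup>2 * ((real m - 1) / n))"
      using m by (simp add: power2_eq_square)
    also have "\<dots> = n * sqrt ((real m - 1) / n)"
      by (simp only: real_sqrt_mult real_sqrt_abs abs_of_nat)
    finally show ?thesis using m by simp
  qed
  finally show ?thesis .
qed


section \<open>The bound on the means\<close>

text \<open>
  Test the difference against a sign vector.  The random map is the block map after a uniformly
  random self-map \<open>h\<close> of \<open>[n]\<close>, and averaging over permutations makes \<open>h\<close> invisible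
  at every basis index on whose support it is injective.
\<close>

lemma mean_bound_deterministic:
  fixes z :: coords
  assumes m: "0 < m" "0 < n" "m dvd n"
    and inv: "\<And>\<sigma> a. \<sigma> permutes {1..n} \<Longrightarrow> a \<in> basis F n \<Longrightarrow> z (imap \<sigma> a) = z a"
  shows "norm1 F m (\<lambda>b. push F n (block n m) z b - (\<Sum>f\<in>maps n m. push F n f z b) / card (maps n m))
    \<le> real (deg F) * (real (deg F) - 1) / n * (\<Sum>a\<in>basis F n. \<bar>z a\<bar>)"
proof -
  let ?b = "block n m"
  let ?D = "\<lambda>b. push F n ?b z b - (\<Sum>f\<in>maps n m. push F n f z b) / card (maps n m)"
  define s where "s b = sgn (?D b)" for b
  have s1: "\<bar>s b\<bar> \<le> 1" for b by (simp add: s_def sgn_if)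
  \<comment> \<open>The pairing of \<open>s\<close> with \<open>push F n f z\<close>, written as a
    sum over source labels so that \<open>f\<close> enters only through
    \<open>imap f a\<close>.\<close>
  define T where "T f = (\<Sum>a\<in>basis F n. z a * s (imap f a))" for f
  have sT: "(\<Sum>b\<in>basis F m. s b * push F n f z b) = T f" if "f \<in> {1..n} \<rightarrow> {1..m}" for f
  proof -
    have "(\<Sum>b\<in>basis F m. s b * push F n f z b) =
        (\<Sum>b\<in>basis F m. \<Sum>a\<in>{a. a \<in> basis F n \<and> imap f a = b}. z a * s (imap f a))"
      unfolding push_def by (intro sum.cong refl) (simp add: sum_distrib_left mult.commute)
    also have "\<dots> = T f"
      unfolding T_def using imap_basis[OF _ that] by (intro sum.group) (auto simp: finite_basis)
    finally show ?thesis .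
  qed
  have "norm1 F m ?D = (\<Sum>b\<in>basis F m. s b * ?D b)"
    unfolding norm1_def s_def by (intro sum.cong refl) (simp add: abs_sgn mult.commute)
  also have "\<dots> = (\<Sum>b\<in>basis F m. s b * push F n ?b z b) -
      (\<Sum>f\<in>maps n m. \<Sum>b\<in>basis F m. s b * push F n f z b) / card (maps n m)"
    by (subst sum.swap) (simp add: right_diff_distrib sum_subtractf sum_distrib_left sum_divide_distrib)
  also have "\<dots> = T ?b - (\<Sum>f\<in>maps n m. T f) / card (maps n m)"
  proof -
    have "(\<Sum>f\<in>maps n m. \<Sum>b\<in>basis F m. s b * push F n f z b) = (\<Sum>f\<in>maps n m. T f)"
      by (intro sum.cong refl sT) (simp add: PiE_iff Pi_iff)
    then show ?thesis using sT[OF block_maps[OF m]] by simp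
  qed
  also have "(\<Sum>f\<in>maps n m. T f) / card (maps n m) = (\<Sum>h\<in>maps n n. T (?b \<circ> h)) / card (maps n n)"
  proof -
    have "T (?b \<circ> h) = T (restrict (?b \<circ> h) {1..n})" for h
    proof -
      have "imap (?b \<circ> h) a = imap (restrict (?b \<circ> h) {1..n}) a" if "a \<in> basis F n" for a
        by (rule imap_cong_basis[OF that]) simp
      then show ?thesis unfolding T_def by simp
    qed
    moreover have "(\<Sum>h\<in>maps n n. T (restrict (?b \<circ> h) {1..n})) / card (maps n n) =
        (\<Sum>f\<in>maps n m. T f) / card (maps n m)"
    proof (rule average_equal_fibres[OF finite_maps maps_nonempty[OF m(2)] finite_maps])
      show "(\<lambda>h. restrict (?b \<circ> h) {1..n}) \<in> maps n n \<rightarrow> maps n m"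
        using block_maps[OF m] by (auto simp: PiE_iff Pi_iff)
      show "card {h \<in> maps n n. restrict (?b \<circ> h) {1..n} = f} = (n div m) ^ n" if "f \<in> maps n m" for f
        by (rule fibre_postcompose[OF block_fibre[OF m] that])
    qed
    ultimately show ?thesis by simp
  qed
  finally have norm: "norm1 F m ?D = T ?b - (\<Sum>h\<in>maps n n. T (?b \<circ> h)) / card (maps n n)" .
  let ?P = "{\<sigma>. \<sigma> permutes {1..n}}"
  have P: "finite ?P" "0 < real (card ?P)"
    by (auto simp: finite_permutations card_gt_0_iff intro: permutes_id)
  \<comment> \<open>The coefficient of \<open>z a\<close> in the pairing after averaging over
    permutations, which the invariance of \<open>z\<close> permits. Right translation in the group
    makes it constant on orbits of labels.\<close>
  define \<Psi> where "\<Psi> a = (\<Sum>\<sigma>\<in>?P. s (imap (?b \<circ> \<sigma>) a)) / card ?P" for a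
  have \<Psi>1: "\<bar>\<Psi> a\<bar> \<le> 1" for a
  proof -
    have "\<bar>\<Sum>\<sigma>\<in>?P. s (imap (?b \<circ> \<sigma>) a)\<bar> \<le> (\<Sum>\<sigma>\<in>?P. 1)"
      by (rule order_trans[OF sum_abs]) (intro sum_mono s1)
    then show ?thesis using P by (simp add: \<Psi>_def)
  qed
  have \<Psi>_perm: "\<Psi> (imap \<tau> a) = \<Psi> a" if "\<tau> permutes {1..n}" for \<tau> a
  proof -
    have "(\<Sum>\<sigma>\<in>?P. s (imap (?b \<circ> \<sigma>) a)) = (\<Sum>\<sigma>\<in>?P. s (imap (?b \<circ> (\<sigma> \<circ> \<tau>)) a))"
      by (rule sum_permutations_compose_right[OF that])
    then show ?thesis by (simp add: \<Psi>_def imap_comp o_assoc)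
  qed
  have 1: "T ?b = (\<Sum>a\<in>basis F n. z a * \<Psi> a)"
  proof -
    have "T (?b \<circ> \<sigma>) = T ?b" if "\<sigma> \<in> ?P" for \<sigma>
    proof -
      have "T (?b \<circ> \<sigma>) = (\<Sum>a\<in>basis F n. z (imap \<sigma> a) * s (imap ?b (imap \<sigma> a)))"
        using that inv by (simp add: T_def imap_comp)
      also have "\<dots> = T ?b"
        unfolding T_def using that by (intro sum_basis_permute) simp
      finally show ?thesis .
    qed
    then have "(\<Sum>\<sigma>\<in>?P. T (?b \<circ> \<sigma>)) = (\<Sum>\<sigma>\<in>?P. T ?b)" by (rule sum.cong[OF refl])
    then have "T ?b = (\<Sum>\<sigma>\<in>?P. T (?b \<circ> \<sigma>)) / card ?P" using P(2) by (simp only: sum_constant) simp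
    also have "\<dots> = (\<Sum>a\<in>basis F n. \<Sum>\<sigma>\<in>?P. z a * s (imap (?b \<circ> \<sigma>) a)) / card ?P"
      unfolding T_def by (subst sum.swap) (rule refl)
    finally show ?thesis by (simp add: \<Psi>_def sum_divide_distrib sum_distrib_left)
  qed
  have 2: "(\<Sum>h\<in>maps n n. T (?b \<circ> h)) / card (maps n n) =
      (\<Sum>h\<in>maps n n. \<Sum>a\<in>basis F n. z a * \<Psi> (imap h a)) / card (maps n n)"
  proof -
    let ?c = "real (card (maps n n))"
    \<comment> \<open>A fixed permutation after a uniform self-map is again uniform, so the average
      over permutations can be inserted here as well.\<close>
    have "(\<Sum>h\<in>maps n n. T (?b \<circ> (\<sigma> \<circ> h))) / ?c = (\<Sum>h\<in>maps n n. T (?b \<circ> h)) / ?c" if "\<sigma> \<in> ?P" for \<sigma>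
    proof -
      have s: "\<sigma> permutes {1..n}" using that by simp
      have "T (?b \<circ> (\<sigma> \<circ> h)) = T (?b \<circ> restrict (\<sigma> \<circ> h) {1..n})" for h
      proof -
        have "imap (?b \<circ> (\<sigma> \<circ> h)) a = imap (?b \<circ> restrict (\<sigma> \<circ> h) {1..n}) a" if "a \<in> basis F n" for a
          by (rule imap_cong_basis[OF that]) simp
        then show ?thesis unfolding T_def by simp
      qed
      moreover have "(\<Sum>h\<in>maps n n. T (?b \<circ> restrict (\<sigma> \<circ> h) {1..n})) / ?c = (\<Sum>h\<in>maps n n. T (?b \<circ> h)) / ?c"
      proof (rule average_equal_fibres[OF finite_maps maps_nonempty[OF m(2)] finite_maps, where h = "\<lambda>h. T (?b \<circ> h)"])
        show "(\<lambda>h. restrict (\<sigma> \<circ> h) {1..n}) \<in> maps n n \<rightarrow> maps n n"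
          using permutes_maps_into[OF s order_refl] by (auto simp: PiE_iff Pi_iff)
        show "card {h \<in> maps n n. restrict (\<sigma> \<circ> h) {1..n} = f} = 1 ^ n" if "f \<in> maps n n" for f
          by (rule fibre_postcompose[OF permutation_fibre[OF s] that])
      qed
      ultimately show ?thesis by simp
    qed
    then have "(\<Sum>\<sigma>\<in>?P. (\<Sum>h\<in>maps n n. T (?b \<circ> (\<sigma> \<circ> h))) / ?c) = (\<Sum>\<sigma>\<in>?P. (\<Sum>h\<in>maps n n. T (?b \<circ> h)) / ?c)"
      by (rule sum.cong[OF refl])
    then have "(\<Sum>h\<in>maps n n. T (?b \<circ> h)) / ?c = (\<Sum>\<sigma>\<in>?P. (\<Sum>h\<in>maps n n. T (?b \<circ> (\<sigma> \<circ> h))) / ?c) / card ?P"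
      using P(2) by (simp only: sum_constant) simp
    also have "\<dots> = (\<Sum>\<sigma>\<in>?P. \<Sum>h\<in>maps n n. T (?b \<circ> (\<sigma> \<circ> h))) / ?c / card ?P"
      by (simp only: sum_divide_distrib)
    also have "(\<Sum>\<sigma>\<in>?P. \<Sum>h\<in>maps n n. T (?b \<circ> (\<sigma> \<circ> h))) =
        (\<Sum>h\<in>maps n n. \<Sum>\<sigma>\<in>?P. \<Sum>a\<in>basis F n. z a * s (imap (?b \<circ> \<sigma>) (imap h a)))"
      unfolding T_def by (subst sum.swap) (simp add: imap_comp o_assoc)
    also have "\<dots> = (\<Sum>h\<in>maps n n. \<Sum>a\<in>basis F n. \<Sum>\<sigma>\<in>?P. z a * s (imap (?b \<circ> \<sigma>) (imap h a)))"
      by (intro sum.cong refl sum.swap)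
    also have "\<dots> = (\<Sum>h\<in>maps n n. \<Sum>a\<in>basis F n. z a * \<Psi> (imap h a)) * card ?P"
      unfolding sum_distrib_right using P(2) by (intro sum.cong refl) (simp add: \<Psi>_def sum_distrib_left)
    finally have "(\<Sum>h\<in>maps n n. T (?b \<circ> h)) / ?c =
        (\<Sum>h\<in>maps n n. \<Sum>a\<in>basis F n. z a * \<Psi> (imap h a)) * card ?P / ?c / card ?P" .
    moreover have "y * real (card ?P) / ?c / real (card ?P) = y / ?c" for y
      using P(2) by simp
    ultimately show ?thesis by (simp only:)
  qed
  have close: "\<bar>\<Psi> a - \<Psi> (imap h a)\<bar> \<le> (if inj_on h (isupp a) then 0 else 2)"
    if a: "a \<in> basis F n" and h: "h \<in> maps n n" for a h
  proof (cases "inj_on h (isupp a)")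
    case True
    have sub: "isupp a \<subseteq> {1..n}" using isupp_basis[OF a] by blast
    then have "h ` isupp a \<subseteq> {1..n}" using PiE_mem[OF h] by blast
    \<comment> \<open>On the support of \<open>a\<close> the map \<open>h\<close> agrees with a
      permutation, and \<open>\<Psi>\<close> does not see permutations.\<close>
    then obtain \<tau> where "\<tau> permutes {1..n}" "\<And>i. i \<in> isupp a \<Longrightarrow> \<tau> i = h i"
      using extend_to_permutation[OF finite_atLeastAtMost sub _ True] by metis
    then have "\<Psi> (imap h a) = \<Psi> a" using \<Psi>_perm imap_cong[of a h \<tau>] by simp
    then show ?thesis by simp
  next
    case False
    then show ?thesis using abs_triangle_ineq4[of "\<Psi> a" "\<Psi> (imap h a)"] \<Psi>1[of a] \<Psi>1[of "imap h a"] by simp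
  qed
  let ?c = "real (card (maps n n))"
  have c: "0 < ?c" using finite_maps maps_nonempty[OF m(2)] by (simp add: card_gt_0_iff del: One_nat_def)
  have "norm1 F m ?D = (\<Sum>a\<in>basis F n. z a * \<Psi> a) - (\<Sum>h\<in>maps n n. \<Sum>a\<in>basis F n. z a * \<Psi> (imap h a)) / ?c"
    unfolding norm 1 2 ..
  also have "(\<Sum>h\<in>maps n n. \<Sum>a\<in>basis F n. z a * \<Psi> (imap h a)) = (\<Sum>a\<in>basis F n. \<Sum>h\<in>maps n n. z a * \<Psi> (imap h a))"
    by (rule sum.swap)
  also have "(\<Sum>a\<in>basis F n. z a * \<Psi> a) - (\<Sum>a\<in>basis F n. \<Sum>h\<in>maps n n. z a * \<Psi> (imap h a)) / ?c =
      (\<Sum>a\<in>basis F n. z a * ((\<Sum>h\<in>maps n n. \<Psi> a - \<Psi> (imap h a)) / ?c))"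
    using c by (simp only: sum_divide_distrib[of _ "basis F n"] sum_subtractf[symmetric])
      (intro sum.cong refl, simp add: sum_subtractf sum_distrib_left[symmetric] diff_divide_distrib right_diff_distrib)
  also have "\<dots> \<le> (\<Sum>a\<in>basis F n. \<bar>z a\<bar> * (real (deg F) * (real (deg F) - 1) / n))"
  proof (intro sum_mono)
    fix a assume a: "a \<in> basis F n"
    let ?k = "card (isupp a)"
    have "\<bar>(\<Sum>h\<in>maps n n. \<Psi> a - \<Psi> (imap h a)) / ?c\<bar> = \<bar>\<Sum>h\<in>maps n n. \<Psi> a - \<Psi> (imap h a)\<bar> / ?c"
      by simp
    also have "\<dots> \<le> (\<Sum>h\<in>maps n n. if inj_on h (isupp a) then 0 else 2) / ?c"
      by (intro divide_right_mono order_trans[OF sum_abs] sum_mono close[OF a]) auto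
    also have "\<dots> \<le> real ?k * (real ?k - 1) / n"
      using isupp_basis[OF a] by (intro average_not_inj) blast
    also have "\<dots> \<le> real (deg F) * (real (deg F) - 1) / n"
    proof (intro divide_right_mono)
      \<comment> \<open>Over the reals \<open>k * (k - 1)\<close> is not monotone near 0; over the
        naturals truncated subtraction makes it so, and the two versions agree at every natural
        number.\<close>
      have "?k * (?k - 1) \<le> deg F * (deg F - 1)"
        using isupp_basis[OF a] by (intro mult_le_mono) auto
      then have "real (?k * (?k - 1)) \<le> real (deg F * (deg F - 1))" by (rule of_nat_mono)
      moreover have "real (k * (k - 1)) = real k * (real k - 1)" for k by (cases k) (auto simp: algebra_simps)
      ultimately show "real ?k * (real ?k - 1) \<le> real (deg F) * (real (deg F) - 1)" by (simp only:)
    qed simp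
    finally have "\<bar>(\<Sum>h\<in>maps n n. \<Psi> a - \<Psi> (imap h a)) / ?c\<bar> \<le> real (deg F) * (real (deg F) - 1) / n" .
    then have "\<bar>z a * ((\<Sum>h\<in>maps n n. \<Psi> a - \<Psi> (imap h a)) / ?c)\<bar> \<le> \<bar>z a\<bar> * (real (deg F) * (real (deg F) - 1) / n)"
      unfolding abs_mult by (rule mult_left_mono) simp
    then show "z a * ((\<Sum>h\<in>maps n n. \<Psi> a - \<Psi> (imap h a)) / ?c) \<le> \<bar>z a\<bar> * (real (deg F) * (real (deg F) - 1) / n)"
      by linarith
  qed
  also have "\<dots> = real (deg F) * (real (deg F) - 1) / n * (\<Sum>a\<in>basis F n. \<bar>z a\<bar>)"
    unfolding sum_distrib_right[symmetric] by (rule mult.commute)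
  finally show ?thesis .
qed

text \<open>\<open>push\<close> is linear in the vector, so the two means are the block image and
  the averaged image of \<open>mean \<mu>\<close>, an invariant vector. It remains to use that the
  norm of the mean is at most the mean of the norm.\<close>

lemma mean_bound:
  assumes m: "0 < m" "0 < n" "m dvd n" and \<mu>: "\<mu> \<in> inv_prob F n S"
    and int: "integrable \<mu> (norm1 F n)"
  shows "norm1 F m (\<lambda>a. mean (distr \<mu> borel (psi_adj F n m)) a - mean (random_image F m n \<mu>) a)
    \<le> real (deg F) * (real (deg F) - 1) / real n * (\<integral>x. norm1 F n x \<partial>\<mu>)"
proof -
  note D = inv_probD[OF \<mu>]
  note coord = integrable_coordinate[OF D(3) int]
  have push_int: "integrable \<mu> (\<lambda>x. push F n f x b)" "(\<integral>x. push F n f x b \<partial>\<mu>) = push F n f (mean \<mu>) b" for f b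
    unfolding push_def mean_def using coord
    by (auto intro!: Bochner_Integration.integrable_sum Bochner_Integration.integral_sum)
  have "mean (distr \<mu> borel (psi_adj F n m)) b = push F n (block n m) (mean \<mu>) b" for b
  proof -
    have "psi_adj F n m = push F n (block n m)" using psi_adj_eq_push[OF m] by blast
    then show ?thesis
      using integral_distr[OF push_measurable'[OF D(3)] coordinate_measurable] push_int(2) by (simp add: mean_def[of "distr _ _ _"])
  qed
  moreover have "mean (random_image F m n \<mu>) b = (\<Sum>f\<in>maps n m. push F n f (mean \<mu>) b) / card (maps n m)" for b
    unfolding random_image_eq push_int(2)[symmetric] unfolding mean_def
    by (rule integral_uniform_pair[where h = "\<lambda>x. x b", OF finite_maps maps_nonempty[OF m(1)] D(2)
          push_measurable'[OF D(3)] coordinate_measurable push_int(1)])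
  ultimately have "norm1 F m (\<lambda>a. mean (distr \<mu> borel (psi_adj F n m)) a - mean (random_image F m n \<mu>) a) \<le>
      real (deg F) * (real (deg F) - 1) / n * (\<Sum>a\<in>basis F n. \<bar>mean \<mu> a\<bar>)"
    using mean_bound_deterministic[OF m, of F "mean \<mu>"] invariant_integral[OF \<mu>, where h = "\<lambda>x. x"]
    by (simp add: mean_def[of \<mu>])
  also have "\<dots> \<le> real (deg F) * (real (deg F) - 1) / n * (\<integral>x. norm1 F n x \<partial>\<mu>)"
  proof (rule mult_left_mono)
    have "(\<Sum>a\<in>basis F n. \<bar>mean \<mu> a\<bar>) \<le> (\<Sum>a\<in>basis F n. \<integral>x. \<bar>x a\<bar> \<partial>\<mu>)"
      unfolding mean_def by (intro sum_mono integral_abs_bound)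
    also have "\<dots> = (\<integral>x. norm1 F n x \<partial>\<mu>)"
      unfolding norm1_def using coord by (intro Bochner_Integration.integral_sum[symmetric] integrable_abs)
    finally show "(\<Sum>a\<in>basis F n. \<bar>mean \<mu> a\<bar>) \<le> (\<integral>x. norm1 F n x \<partial>\<mu>)" .
    show "0 \<le> real (deg F) * (real (deg F) - 1) / n" by (cases "deg F") auto
  qed
  finally show ?thesis .
qed


section \<open>The map between the limits\<close>

text \<open>A step has both ends in \<open>level_measures\<close>, so the symmetrized measure is a
  probability measure, as \<open>random_image_symmetrize\<close> requires.\<close>

lemma describe_sym_step:
  assumes "sym_step F \<Omega> p q"
  shows "describe F p = describe F q"
proof -
  obtain n \<mu> where p: "p = (n, \<mu>)" by (cases p)
  obtain N \<nu> where q: "q = (N, \<nu>)" by (cases q)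
  have \<mu>: "\<mu> \<in> inv_prob F n (\<Omega> n)" and \<nu>: "\<nu> \<in> inv_prob F N (\<Omega> N)" and step: "n \<le> N" "\<nu> = symmetrize F N n \<mu>"
    using assms by (auto simp: sym_step_def level_measures_def p q)
  have "random_image F m n \<mu> = random_image F m N \<nu>" if "0 < m" for m
    using random_image_symmetrize[OF inv_probD(3,2)[OF \<mu>], of F N n m] inv_probD(2)[OF \<nu>] step that by simp
  then show ?thesis by (auto simp: describe_def p q intro!: restrict_ext)
qed

lemma describe_sym_equiv:
  assumes "(p, q) \<in> sym_equiv F \<Omega>"
  shows "describe F p = describe F q"
proof -
  have "equivclp (sym_step F \<Omega>) p q" using assms by (simp add: sym_equiv_def)
  then show ?thesis
  proof (induction rule: equivclp_induct)
    case (step y z)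
    then show ?case using describe_sym_step by metis
  qed simp
qed

lemma equiv_sym_equiv: "equiv (level_measures F \<Omega>) (sym_equiv F \<Omega>)"
proof (rule equivI)
  show "sym_equiv F \<Omega> \<subseteq> level_measures F \<Omega> \<times> level_measures F \<Omega>" by (auto simp: sym_equiv_def)
  show "refl_on (level_measures F \<Omega>) (sym_equiv F \<Omega>)" by (auto simp: refl_on_def sym_equiv_def)
  show "sym (sym_equiv F \<Omega>)" by (auto simp: sym_def sym_equiv_def intro: equivclp_sym)
  show "trans (sym_equiv F \<Omega>)" by (auto simp: trans_def sym_equiv_def intro: equivclp_trans)
qed

lemma describe_class_eq:
  assumes "p \<in> level_measures F \<Omega>"
  shows "describe_class F (sym_equiv F \<Omega> `` {p}) = describe F p"
proof -
  have "p \<in> sym_equiv F \<Omega> `` {p}"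
    using equiv_class_self[OF equiv_sym_equiv assms] .
  then have "describe F ` (sym_equiv F \<Omega> `` {p}) = {describe F p}"
    using describe_sym_equiv by fastforce
  then show ?thesis by (simp add: describe_class_def)
qed

text \<open>Full mass on the sets comes from \<open>push_image_subset\<close>, coherence from
  \<open>distr_random_image_push\<close> with the block map.\<close>

lemma describe_in_inv_lim:
  assumes "\<And>n. 0 < n \<Longrightarrow> compact (\<Omega> n)"
    and "\<And>n \<sigma>. 0 < n \<Longrightarrow> \<sigma> permutes {1..n} \<Longrightarrow> act F n \<sigma> ` \<Omega> n \<subseteq> \<Omega> n"
    and "\<And>n N. 0 < n \<Longrightarrow> 0 < N \<Longrightarrow> n dvd N \<Longrightarrow> psi_adj F N n ` \<Omega> N \<subseteq> \<Omega> n"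
    and "\<And>n N. 0 < n \<Longrightarrow> n \<le> N \<Longrightarrow> phi F N n ` \<Omega> n \<subseteq> \<Omega> N"
    and p: "p \<in> level_measures F \<Omega>"
  shows "describe F p \<in> inv_lim F \<Omega>"
proof -
  obtain n \<mu> where p': "p = (n, \<mu>)" by (cases p)
  then have n: "0 < n" and \<mu>: "\<mu> \<in> inv_prob F n (\<Omega> n)" using p by (auto simp: level_measures_def)
  note D = inv_probD[OF \<mu>]
  have "random_image F m n \<mu> \<in> inv_prob F m (\<Omega> m)" if m: "0 < m" for m
    using push_image_subset[of F \<Omega>, OF assms(2,3,4) n m] compact_coords_measurable[OF assms(1)[OF m]]
    by (intro random_image_inv_prob[OF \<mu> m]) auto
  moreover have "distr (random_image F M n \<mu>) borel (psi_adj F M m) = random_image F m n \<mu>"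
    if m: "0 < m" "0 < M" "m dvd M" for m M
  proof -
    have "psi_adj F M m = push F M (block M m)" using psi_adj_eq_push[OF m] by blast
    then show ?thesis
      using distr_random_image_push[OF D(3,2) m(2) block_maps[OF m] block_fibre[OF m]] by simp
  qed
  ultimately show ?thesis
    by (auto simp: inv_lim_def describe_def p')
qed

lemma inv_lim_dense:
  assumes bdd: "bdd_above (\<Union>n\<in>{0<..}. norm1 F n ` \<Omega> n)"
    and \<mu>: "\<mu> \<in> inv_lim F \<Omega>"
  shows "\<exists>\<nu> :: nat \<Rightarrow> nat \<Rightarrow> coords measure.
    (\<forall>i. \<nu> i \<in> describe_class F ` dir_lim F \<Omega>) \<and> (\<forall>m>0. (\<lambda>i. W1 F m (\<mu> m) (\<nu> i m)) \<longlonglongrightarrow> 0)"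
proof -
  obtain B where "\<And>y. y \<in> (\<Union>n\<in>{0<..}. norm1 F n ` \<Omega> n) \<Longrightarrow> y \<le> B"
    using bdd by (auto simp: bdd_above_def)
  then have B: "norm1 F n x \<le> B" if "0 < n" "x \<in> \<Omega> n" for n x using that by blast
  \<comment> \<open>Every positive \<open>m\<close> up to \<open>Suc i\<close> divides
    \<open>N i\<close>, and \<open>Suc i <= N i\<close> turns the bound into the null sequence
    \<open>?u\<close>.\<close>
  define N where "N i = (fact (Suc i) :: nat)" for i
  have N: "0 < N i" "Suc i \<le> N i" for i by (simp_all only: N_def fact_gt_zero fact_ge_self)
  define \<nu> where "\<nu> i = describe F (N i, \<mu> (N i))" for i
  have lev: "\<mu> n \<in> inv_prob F n (\<Omega> n)" if "0 < n" for n
    using \<mu> that by (auto simp: inv_lim_def PiE_iff)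
  have "\<nu> i \<in> describe_class F ` dir_lim F \<Omega>" for i
  proof -
    have l: "(N i, \<mu> (N i)) \<in> level_measures F \<Omega>"
      using lev[OF N(1)] N(1) by (simp add: level_measures_def)
    then have "sym_equiv F \<Omega> `` {(N i, \<mu> (N i))} \<in> dir_lim F \<Omega>"
      unfolding dir_lim_def by (rule quotientI)
    then show ?thesis using describe_class_eq[OF l] unfolding \<nu>_def by (metis imageI)
  qed
  moreover have "(\<lambda>i. W1 F m (\<mu> m) (\<nu> i m)) \<longlonglongrightarrow> 0" if m: "0 < m" for m
  proof (rule tendsto_sandwich)
    let ?u = "\<lambda>i. 2 * real (deg F) * sqrt ((real m - 1) / real (Suc i)) * max 0 B"
    show "\<forall>\<^sub>F i in sequentially. 0 \<le> W1 F m (\<mu> m) (\<nu> i m)" by simp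
    show "(\<lambda>i. 0 :: ennreal) \<longlonglongrightarrow> 0" by simp
    have "(\<lambda>i. ?u i) \<longlonglongrightarrow> 2 * real (deg F) * sqrt 0 * max 0 B"
      by (intro tendsto_intros LIMSEQ_Suc lim_const_over_n)
    then have "(\<lambda>i. ennreal (?u i)) \<longlonglongrightarrow> ennreal 0" by (intro tendsto_ennrealI) simp
    then show "(\<lambda>i. ennreal (?u i)) \<longlonglongrightarrow> 0" by simp
    show "\<forall>\<^sub>F i in sequentially. W1 F m (\<mu> m) (\<nu> i m) \<le> ennreal (?u i)"
      using eventually_ge_at_top[of m]
    proof eventually_elim
      case (elim i)
      have dvd: "m dvd N i" unfolding N_def using m elim by (intro dvd_fact) auto
      note \<mu>N = lev[OF N(1)[of i]]
      interpret prob_space "\<mu> (N i)" by (rule inv_probD(1)[OF \<mu>N])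
      have meas: "norm1 F (N i) \<in> borel_measurable (\<mu> (N i))"
      proof -
        note [measurable] = coordinate_measurable
        have "norm1 F (N i) \<in> borel_measurable borel" unfolding norm1_def by measurable
        then show ?thesis using measurable_cong_sets[OF inv_probD(3)[OF \<mu>N] refl] by blast
      qed
      have "prob (\<Omega> (N i)) = 1" using inv_probD(5)[OF \<mu>N] by (simp add: measure_def)
      then have "AE x in \<mu> (N i). x \<in> \<Omega> (N i)" by (rule AE_prob_1)
      then have bound: "AE x in \<mu> (N i). norm1 F (N i) x \<le> B"
        by (rule AE_mp) (use B[OF N(1)] in \<open>auto intro!: AE_I2\<close>)
      have pos: "0 \<le> norm1 F k x" for k x by (simp add: norm1_def sum_nonneg)
      have int: "integrable (\<mu> (N i)) (norm1 F (N i))"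
      proof (rule integrable_const_bound[OF _ meas])
        show "AE x in \<mu> (N i). norm (norm1 F (N i) x) \<le> B" using bound pos by simp
      qed
      \<comment> \<open>The coherent family supplies its own approximants: its member at level
        \<open>m\<close> is exactly the projection compared in \<open>W1_bound\<close>.\<close>
      have "distr (\<mu> (N i)) borel (psi_adj F (N i) m) = \<mu> m"
        using \<mu> m N(1) dvd by (simp add: inv_lim_def)
      then have "W1 F m (\<mu> m) (\<nu> i m) \<le>
          ennreal (2 * real (deg F) * sqrt ((real m - 1) / N i) * (\<integral>x. norm1 F (N i) x \<partial>\<mu> (N i)))"
        using W1_bound[OF m N(1) dvd \<mu>N int] m by (simp add: \<nu>_def describe_def)
      also have "\<dots> \<le> ennreal (?u i)"
      proof (intro ennreal_leI mult_mono order_refl)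
        show "sqrt ((real m - 1) / N i) \<le> sqrt ((real m - 1) / real (Suc i))"
          using m N(2)[of i] by (intro real_sqrt_le_mono divide_left_mono) auto
        have "(\<integral>x. norm1 F (N i) x \<partial>\<mu> (N i)) \<le> B"
          by (rule integral_le_const[OF int bound])
        then show "(\<integral>x. norm1 F (N i) x \<partial>\<mu> (N i)) \<le> max 0 B" by simp
        show "0 \<le> (\<integral>x. norm1 F (N i) x \<partial>\<mu> (N i))"
          by (intro integral_nonneg_AE AE_I2 pos)
      qed (use m in auto)
      finally show ?case .
    qed
  qed
  ultimately show ?thesis by blast
qed

theorem theorem4p9:
  fixes F :: construction and \<Omega> :: "nat \<Rightarrow> coords set"
  assumes "\<And>n. 0 < n \<Longrightarrow> \<Omega> n \<subseteq> space_of F n"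
    and "\<And>n. 0 < n \<Longrightarrow> compact (\<Omega> n)"
    and "\<And>n \<sigma>. 0 < n \<Longrightarrow> \<sigma> permutes {1..n} \<Longrightarrow> act F n \<sigma> ` \<Omega> n \<subseteq> \<Omega> n"
    and "\<And>n N. 0 < n \<Longrightarrow> 0 < N \<Longrightarrow> n dvd N \<Longrightarrow> psi_adj F N n ` \<Omega> N \<subseteq> \<Omega> n"
    and "\<And>n N. 0 < n \<Longrightarrow> n \<le> N \<Longrightarrow> phi F N n ` \<Omega> n \<subseteq> \<Omega> N"
    and "bdd_above (\<Union>n\<in>{0<..}. norm1 F n ` \<Omega> n)"
  shows "describe F respects sym_equiv F \<Omega>
    \<and> describe_class F \<in> dir_lim F \<Omega> \<rightarrow> inv_lim F \<Omega>
    \<and> (\<forall>\<mu>\<in>inv_lim F \<Omega>. \<exists>\<nu> :: nat \<Rightarrow> nat \<Rightarrow> coords measure.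
          (\<forall>i. \<nu> i \<in> describe_class F ` dir_lim F \<Omega>) \<and>
          (\<forall>m>0. (\<lambda>i. W1 F m (\<mu> m) (\<nu> i m)) \<longlonglongrightarrow> 0))
    \<and> (\<forall>n m \<mu>. 0 < m \<longrightarrow> 0 < n \<longrightarrow> m dvd n \<longrightarrow> \<mu> \<in> inv_prob F n (space_of F n) \<longrightarrow>
          integrable \<mu> (norm1 F n) \<longrightarrow>
          W1 F m (distr \<mu> borel (psi_adj F n m)) (random_image F m n \<mu>)
            \<le> ennreal (2 * real (deg F) * sqrt (real m * (real m - 1) / (real n / real m))
                        * (\<integral>x. norm1 F n x \<partial>\<mu>)) \<and>
          norm1 F m (\<lambda>a. mean (distr \<mu> borel (psi_adj F n m)) a - mean (random_image F m n \<mu>) a)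
            \<le> real (deg F) * (real (deg F) - 1) / real n * (\<integral>x. norm1 F n x \<partial>\<mu>))"
proof (intro conjI allI impI ballI)
  show "describe F respects sym_equiv F \<Omega>"
    by (rule congruentI) (rule describe_sym_equiv)
  show "describe_class F \<in> dir_lim F \<Omega> \<rightarrow> inv_lim F \<Omega>"
  proof
    fix C assume "C \<in> dir_lim F \<Omega>"
    then obtain p where p: "p \<in> level_measures F \<Omega>" "C = sym_equiv F \<Omega> `` {p}"
      unfolding dir_lim_def by (rule quotientE)
    show "describe_class F C \<in> inv_lim F \<Omega>"
      unfolding p(2) describe_class_eq[OF p(1)] by (rule describe_in_inv_lim[OF assms(2-5) p(1)])
  qed
  show "\<exists>\<nu> :: nat \<Rightarrow> nat \<Rightarrow> coords measure. (\<forall>i. \<nu> i \<in> describe_class F ` dir_lim F \<Omega>) \<and>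
      (\<forall>m>0. (\<lambda>i. W1 F m (\<mu> m) (\<nu> i m)) \<longlonglongrightarrow> 0)" if "\<mu> \<in> inv_lim F \<Omega>" for \<mu>
    by (rule inv_lim_dense[OF assms(6) that])
next
  fix n m :: nat and \<mu> :: "coords measure"
  assume m: "0 < m" "0 < n" "m dvd n" and \<mu>: "\<mu> \<in> inv_prob F n (space_of F n)" and int: "integrable \<mu> (norm1 F n)"
  have I: "0 \<le> (\<integral>x. norm1 F n x \<partial>\<mu>)"
    by (intro integral_nonneg_AE AE_I2) (simp add: norm1_def sum_nonneg)
  \<comment> \<open>The right-hand side is \<open>m ^ 2\<close> times the left-hand side.\<close>
  have "(real m - 1) / n \<le> real m * (real m - 1) / (real n / real m)"
  proof -
    have "1 * (real m - 1) \<le> (real m * real m) * (real m - 1)"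
      using m by (intro mult_right_mono) (auto simp: mult_ge1_I)
    then have "(real m - 1) / n \<le> (real m * real m) * (real m - 1) / n"
      by (intro divide_right_mono) auto
    then show ?thesis by (simp add: mult_ac)
  qed
  then have "2 * real (deg F) * sqrt ((real m - 1) / n) * (\<integral>x. norm1 F n x \<partial>\<mu>) \<le>
      2 * real (deg F) * sqrt (real m * (real m - 1) / (real n / real m)) * (\<integral>x. norm1 F n x \<partial>\<mu>)"
    by (intro mult_right_mono mult_left_mono real_sqrt_le_mono I) auto
  then show "W1 F m (distr \<mu> borel (psi_adj F n m)) (random_image F m n \<mu>)
      \<le> ennreal (2 * real (deg F) * sqrt (real m * (real m - 1) / (real n / real m)) * (\<integral>x. norm1 F n x \<partial>\<mu>))"
    using W1_bound[OF m \<mu> int] by (meson ennreal_leI order_trans)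
  show "norm1 F m (\<lambda>a. mean (distr \<mu> borel (psi_adj F n m)) a - mean (random_image F m n \<mu>) a)
      \<le> real (deg F) * (real (deg F) - 1) / real n * (\<integral>x. norm1 F n x \<partial>\<mu>)"
    by (rule mean_bound[OF m \<mu> int])
qed

end
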